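(* Let $m,n\geq 1$. Let $\psi:\mathcal{MC}_n^{(m)}\to\mathcal{MS}_n^{(m)}$ be the function that associates with a metasylvester $m$-chain $c=(\sigma^{(m)},\dots,\sigma^{(1)})$ of size $n$ the metasylvester class whose set of tree-inversions is $$\mathcal{I}(c)=\{(a,b_i)\;:\;1\leq i\leq m,\ (a,b)\in\mathrm{coinv}(\sigma^{(i)})\}.$$ Then $\psi$ is a (well-defined) bijection between the set $\mathcal{MC}_n^{(m)}$ of metasylvester $m$-chains of size $n$ and the set $\mathcal{MS}_n^{(m)}$ of metasylvester classes of $m$-permutations of size $n$.
   Context: For a permutation $\sigma\in\mathfrak{S}_n$, written as a word, $\mathrm{coinv}(\sigma)$ is the set of couples $(a,b)$ with $a<b$ such that $b$ appears before $a$ in $\sigma$. The right weak order on $\mathfrak{S}_n$ is: $\sigma\leq\mu$ iff $\mathrm{coinv}(\sigma)\subseteq\mathrm{coinv}(\mu)$. A metasylvester $m$-chain of size $n$ is a list $(\sigma^{(m)},\sigma^{(m-1)},\dots,\sigma^{(1)})$ of permutations in $\mathfrak{S}_n$ with $\sigma^{(m)}\leq\sigma^{(m-1)}\leq\dots\leq\sigma^{(1)}$ in the right weak order and such that for all $i<j$ the permutation $(\sigma^{(j)})^{-1}\sigma^{(i)}$ (composition $(fg)(k)=f(g(k))$) avoids the pattern $231$. An $m$-permutation of size $n$ is a rearrangement of the word $1^m2^m\cdots n^m$; their set is $\mathfrak{S}_n^{(m)}$. For a letter $b$, $b_i$ denotes the $i$-th occurrence of $b$ from the left. The order on $\mathfrak{S}_n^{(m)}$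 is inclusion of the sets of co-inversions $(a_i,b_j)$ ($a<b$ and $b_j$ appears before $a_i$). The metasylvester congruence $\equiv$ on $\mathfrak{S}_n^{(m)}$ is the equivalence relation generated by $u\,ac\,v\,a\,w\equiv u\,ca\,v\,a\,w$ for letters $a<c$ and words $u,v,w$, and $u\,b\,v\,ac\,w\,b\,x\equiv u\,b\,v\,ca\,w\,b\,x$ for letters $a<b<c$ and words $u,v,w,x$. Each class contains a unique maximal element, the only one in the class containing no subword (not necessarily consecutive) $a\cdots b\cdots a$ with $a<b$. For $1\leq a<b\leq n$ and $1\leq i\leq m$, the couple $(a,b_i)$ is a tree-inversion of a metasylvester class (and of each of its elements) if, in the maximal element of the class, all letters $a$ are placed after the $i$-th occurrence of $b$. A metasylvester class is uniquely determined by its set of tree-inversions. *)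

theory Defs
  imports "HOL-Combinatorics.Combinatorics"
begin

section \<open>Permutations and metasylvester chains\<close>

text \<open>
  A permutation of size n is a function s with \<^term>\<open>s permutes {1..n}\<close>;
  as a word it is s 1, s 2, ..., s n.
\<close>

definition coinv :: "nat \<Rightarrow> (nat \<Rightarrow> nat) \<Rightarrow> (nat \<times> nat) set" where
  "coinv n s =
    {(a, b). a < b \<and> (\<exists>k l. 1 \<le> k \<and> k < l \<and> l \<le> n \<and> s k = b \<and> s l = a)}"

definition weak_le :: "nat \<Rightarrow> (nat \<Rightarrow> nat) \<Rightarrow> (nat \<Rightarrow> nat) \<Rightarrow> bool" where
  "weak_le n s t \<longleftrightarrow> coinv n s \<subseteq> coinv n t"

definition avoids_231 :: "nat \<Rightarrow> (nat \<Rightarrow> nat) \<Rightarrow> bool" where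
  "avoids_231 n p \<longleftrightarrow>
    \<not> (\<exists>i j k. 1 \<le> i \<and> i < j \<and> j < k \<and> k \<le> n \<and> p k < p i \<and> p i < p j)"

text \<open>
  An m-chain is a list written in decreasing order of its superscripts: the head is
  entry m and the last element is entry 1.
\<close>

definition chain_entry :: "nat \<Rightarrow> (nat \<Rightarrow> nat) list \<Rightarrow> nat \<Rightarrow> (nat \<Rightarrow> nat)" where
  "chain_entry m c i = c ! (m - i)"

definition metasylv_chains :: "nat \<Rightarrow> nat \<Rightarrow> (nat \<Rightarrow> nat) list set" where
  "metasylv_chains n m =
    {c. length c = m \<and>
        (\<forall>s\<in>set c. s permutes {1..n}) \<and>
        (\<forall>i. 1 \<le> i \<and> i < m \<longrightarrow> weak_le n (chain_entry m c (i + 1)) (chain_entry m c i)) \<and>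
        (\<forall>i j. 1 \<le> i \<and> i < j \<and> j \<le> m \<longrightarrow>
           avoids_231 n (inv (chain_entry m c j) \<circ> chain_entry m c i))}"

text \<open>The couple (a, b_i) is encoded as \<^term>\<open>(a, (b, i))\<close>.\<close>

definition chain_inversions ::
    "nat \<Rightarrow> nat \<Rightarrow> (nat \<Rightarrow> nat) list \<Rightarrow> (nat \<times> (nat \<times> nat)) set" where
  "chain_inversions n m c =
    {(a, (b, i)). 1 \<le> i \<and> i \<le> m \<and> (a, b) \<in> coinv n (chain_entry m c i)}"


section \<open>m-permutations and metasylvester classes\<close>

definition mperms :: "nat \<Rightarrow> nat \<Rightarrow> nat list set" where
  "mperms n m = {w. mset w = mset (concat (map (replicate m) [1..<Suc n]))}"

text \<open>
  The labelled letter at (0-based) position p of w: \<^term>\<open>(b, i)\<close> if the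
  letter there is the i-th occurrence of b from the left, with i counted from 1.
\<close>

definition labelled :: "nat list \<Rightarrow> nat \<Rightarrow> nat \<times> nat" where
  "labelled w p = (w ! p, count_list (take (Suc p) w) (w ! p))"

definition word_coinv :: "nat list \<Rightarrow> ((nat \<times> nat) \<times> (nat \<times> nat)) set" where
  "word_coinv w =
    {((a, i), (b, j)). a < b \<and>
       (\<exists>p q. p < q \<and> q < length w \<and> labelled w p = (b, j) \<and> labelled w q = (a, i))}"

definition word_le :: "nat list \<Rightarrow> nat list \<Rightarrow> bool" where
  "word_le u v \<longleftrightarrow> word_coinv u \<subseteq> word_coinv v"

inductive metasylv_step :: "nat list \<Rightarrow> nat list \<Rightarrow> bool" where
  "a < c \<Longrightarrow>
     metasylv_step (u @ [a, c] @ v @ [a] @ w) (u @ [c, a] @ v @ [a] @ w)"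
| "a < b \<Longrightarrow> b < c \<Longrightarrow>
     metasylv_step (u @ [b] @ v @ [a, c] @ w @ [b] @ x) (u @ [b] @ v @ [c, a] @ w @ [b] @ x)"

definition metasylv_cong :: "nat \<Rightarrow> nat \<Rightarrow> (nat list \<times> nat list) set" where
  "metasylv_cong n m =
    {(u, v). u \<in> mperms n m \<and> v \<in> mperms n m \<and>
       equivclp (\<lambda>x y. x \<in> mperms n m \<and> y \<in> mperms n m \<and> metasylv_step x y) u v}"

lemma equiv_metasylv_cong: "equiv (mperms n m) (metasylv_cong n m)"
  by (rule equivI)
    (auto simp: metasylv_cong_def refl_on_def sym_def trans_def
      intro: equivclp_sym equivclp_trans)

definition metasylv_classes :: "nat \<Rightarrow> nat \<Rightarrow> nat list set set" where
  "metasylv_classes n m = mperms n m // metasylv_cong n m"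

definition is_maximal_in :: "nat list set \<Rightarrow> nat list \<Rightarrow> bool" where
  "is_maximal_in C w \<longleftrightarrow> w \<in> C \<and> (\<forall>v\<in>C. word_le w v \<longrightarrow> v = w)"

text \<open>Every metasylvester class has exactly one maximal element.\<close>

definition max_elem :: "nat list set \<Rightarrow> nat list" where
  "max_elem C = (THE w. is_maximal_in C w)"

definition tree_inversions ::
    "nat \<Rightarrow> nat \<Rightarrow> nat list set \<Rightarrow> (nat \<times> (nat \<times> nat)) set" where
  "tree_inversions n m C =
    {(a, (b, i)). 1 \<le> a \<and> a < b \<and> b \<le> n \<and> 1 \<le> i \<and> i \<le> m \<and>
       (\<exists>p < length (max_elem C). labelled (max_elem C) p = (b, i) \<and>
          (\<forall>q < length (max_elem C). max_elem C ! q = a \<longrightarrow> p < q))}"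

definition psi :: "nat \<Rightarrow> nat \<Rightarrow> (nat \<Rightarrow> nat) list \<Rightarrow> nat list set" where
  "psi n m c =
    (THE C. C \<in> metasylv_classes n m \<and> tree_inversions n m C = chain_inversions n m c)"

end

theory Submission
  imports Defs "HOL-Library.Confluence"
begin

text \<open>
  Oriented so that co-inversions increase, the metasylvester relations form a terminating, locally
  confluent rewriting system, whose irreducible words are those avoiding aba with a < b; so every
  class contains exactly one such word, and it is the maximal element. In an avoiding word the
  copies of a are not separated by larger letters, so the relative order of two labelled letters
  is read off the tree-inversions, which therefore determine the word.

  From an avoiding word, \<open>\<sigma>\<^sup>i\<close> is obtained as the subword of the i-th occurrences. Conversely, the
  tree-inversions of a chain define a tournament on the labelled letters; a 3-cycle in it would
  give two indices i < j at which the chain contains the forbidden pattern 231, so the tournament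
  is a linear order, i.e. a word, and this word avoids aba.
\<close>

section \<open>Words as orders on labelled letters\<close>

text \<open>In a word avoiding aba, for letters a < b, the order of \<open>a_k\<close> and
  \<open>b_j\<close> does not depend on k. Either \<open>b_j\<close> precedes every copy of a, or
  some copy of a stands to its left and then no copy may stand to its right. So the comparison is
  that of a and b in the single permutation \<open>\<sigma>\<^sup>j\<close>, the one indexed by the
  larger letter. This is how a chain prescribes the order of all labelled letters, including those
  with different indices. The two chain conditions have separate duties. The weak order says that
  \<open>b_i\<close> precedes all copies of a whenever \<open>b_j\<close> does, for i < j; this
  excludes 3-cycles through two copies of one letter. Three different letters are compared at two
  indices at least, and there the avoidance of 231 enters. Words are handled through their lists of
  labelled letters: these lists have no repetitions, so that a word becomes a strict linear order
  and is determined by it.\<close>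

primrec precedes :: "'a list \<Rightarrow> 'a \<Rightarrow> 'a \<Rightarrow> bool" where
  "precedes [] x y \<longleftrightarrow> False"
| "precedes (z # zs) x y \<longleftrightarrow> x = z \<and> y \<in> set zs \<or> precedes zs x y"

lemma precedes_append:
  "precedes (xs @ ys) x y \<longleftrightarrow> precedes xs x y \<or> precedes ys x y \<or> x \<in> set xs \<and> y \<in> set ys"
  by (induction xs) auto

lemma precedes_in_set: "precedes xs x y \<Longrightarrow> x \<in> set xs \<and> y \<in> set xs"
  by (induction xs) auto

lemma precedes_iff_nth:
  "precedes xs x y \<longleftrightarrow> (\<exists>p q. p < q \<and> q < length xs \<and> xs ! p = x \<and> xs ! q = y)"
proof (induction xs)
  case (Cons z zs)
  have "(\<exists>p q. p < q \<and> q < Suc (length zs) \<and> (z # zs) ! p = x \<and> (z # zs) ! q = y) \<longleftrightarrow>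
    (\<exists>q. q < length zs \<and> z = x \<and> zs ! q = y) \<or>
    (\<exists>p q. p < q \<and> q < length zs \<and> zs ! p = x \<and> zs ! q = y)" (is "?l \<longleftrightarrow> ?r")
  proof
    assume ?l
    then obtain p q where pq: "p < q" "q < Suc (length zs)" "(z # zs) ! p = x" "(z # zs) ! q = y"
      by blast
    obtain q' where "q = Suc q'" using pq(1) by (cases q) auto
    with pq show ?r by (cases p) auto
  next
    assume ?r
    then show ?l
    proof (elim disjE exE conjE)
      fix q assume "q < length zs" "z = x" "zs ! q = y"
      then show ?l by (intro exI[of _ 0] exI[of _ "Suc q"]) auto
    next
      fix p q assume "p < q" "q < length zs" "zs ! p = x" "zs ! q = y"
      then show ?l by (intro exI[of _ "Suc p"] exI[of _ "Suc q"]) auto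
    qed
  qed
  then show ?case using Cons.IH by (auto simp: in_set_conv_nth)
qed simp

lemma precedes_trans:
  "distinct xs \<Longrightarrow> precedes xs x y \<Longrightarrow> precedes xs y z \<Longrightarrow> precedes xs x z"
  by (induction xs) (auto dest: precedes_in_set)

lemma precedes_total: "x \<in> set xs \<Longrightarrow> y \<in> set xs \<Longrightarrow> x \<noteq> y \<Longrightarrow> precedes xs x y \<or> precedes xs y x"
  by (induction xs) auto

lemma sorted_wrt_precedesD: "sorted_wrt R xs \<Longrightarrow> precedes xs x y \<Longrightarrow> R x y"
  by (induction xs) auto

lemma sorted_wrt_precedes: "sorted_wrt (precedes xs) xs"
  by (auto simp: sorted_wrt_iff_nth_less precedes_iff_nth)

section \<open>Lists sorted by an asymmetric or total relation\<close>

text \<open>If the heads differed, each would lie in the tail of the other list, and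
  \<open>R\<close> would hold in both directions. Asymmetry implies irreflexivity, so a head does
  not recur in its tail and the tails have equal sets.\<close>

lemma sorted_wrt_asymp_unique:
  assumes asym: "\<And>x y. R x y \<Longrightarrow> \<not> R y x"
  shows "sorted_wrt R xs \<Longrightarrow> sorted_wrt R ys \<Longrightarrow> set xs = set ys \<Longrightarrow> xs = ys"
proof (induction xs arbitrary: ys)
  case (Cons x xs)
  then obtain y zs where ys: "ys = y # zs" by (cases ys) auto
  have R: "\<And>z. z \<in> set xs \<Longrightarrow> R x z" "\<And>z. z \<in> set zs \<Longrightarrow> R y z"
    using Cons.prems(1,2) ys by auto
  have sets: "insert x (set xs) = insert y (set zs)" using Cons.prems(3) ys by simp
  have "x = y"
  proof (rule ccontr)
    assume "x \<noteq> y"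
    then have "R x y" "R y x" using R sets by (metis insert_iff)+
    then show False using asym by blast
  qed
  moreover have "x \<notin> set xs" "y \<notin> set zs" using R asym by blast+
  ultimately have "set xs = set zs" using sets insert_ident by metis
  then show ?case using Cons.IH[of zs] Cons.prems(1,2) ys \<open>x = y\<close> by simp
qed simp

text \<open>The new element is inserted between its \<open>R\<close>-predecessors and the rest;
  transitivity through it relates the two blocks, whatever their former interleaving.\<close>

lemma ex_sorted_wrt:
  assumes "finite A"
    and "\<And>x y. x \<in> A \<Longrightarrow> y \<in> A \<Longrightarrow> x \<noteq> y \<Longrightarrow> R x y \<or> R y x"
    and "\<And>x y z. x \<in> A \<Longrightarrow> y \<in> A \<Longrightarrow> z \<in> A \<Longrightarrow> R x y \<Longrightarrow> R y z \<Longrightarrow> R x z"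
  shows "\<exists>xs. sorted_wrt R xs \<and> set xs = A"
  using assms
proof (induction A rule: finite_induct)
  case empty
  show ?case by simp
next
  case (insert x A)
  note tot = insert.prems(1) and tr = insert.prems(2)
  have "\<exists>xs. sorted_wrt R xs \<and> set xs = A"
  proof (rule insert.IH)
    show "R a b \<or> R b a" if "a \<in> A" "b \<in> A" "a \<noteq> b" for a b
      using that by (intro tot) auto
    show "R a c" if "a \<in> A" "b \<in> A" "c \<in> A" "R a b" "R b c" for a b c
      by (rule tr[of a b c]) (use that in simp_all)
  qed
  then obtain xs where xs: "sorted_wrt R xs" "set xs = A" by blast
  define ys where "ys = filter (\<lambda>y. R y x) xs @ x # filter (\<lambda>y. \<not> R y x) xs"
  have after: "R x y" if "y \<in> A" "\<not> R y x" for y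
  proof -
    have "x \<noteq> y" using insert.hyps(2) that(1) by auto
    then show ?thesis using tot[of x y] that by simp
  qed
  have "R y z" if "y \<in> A" "z \<in> A" "R y x" "\<not> R z x" for y z
    by (rule tr[of y x z]) (simp_all add: that after)
  then have "\<forall>y\<in>set (filter (\<lambda>y. R y x) xs). \<forall>z\<in>set (x # filter (\<lambda>y. \<not> R y x) xs). R y z"
    unfolding set_filter list.set xs(2) by blast
  moreover have "\<forall>z\<in>set (filter (\<lambda>y. \<not> R y x) xs). R x z"
    unfolding set_filter xs(2) using after by blast
  ultimately have "sorted_wrt R ys"
    unfolding ys_def sorted_wrt_append sorted_wrt.simps using xs(1) sorted_wrt_filter by blast
  moreover have "set ys = insert x A" unfolding ys_def using xs(2) by auto
  ultimately show ?case by blast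
qed

section \<open>Labelled letters of a word\<close>

definition labels :: "nat list \<Rightarrow> (nat \<times> nat) list" where
  "labels w = map (labelled w) [0..<length w]"

lemma length_labels [simp]: "length (labels w) = length w"
  by (simp add: labels_def)

lemma labels_nth: "p < length w \<Longrightarrow> labels w ! p = labelled w p"
  by (simp add: labels_def)

lemma labels_Nil [simp]: "labels [] = []"
  by (simp add: labels_def)

lemma labels_snoc: "labels (w @ [b]) = labels w @ [(b, Suc (count_list w b))]"
  by (simp add: labels_def labelled_def nth_append)

lemma map_fst_labels: "map fst (labels w) = w"
  by (rule nth_equalityI) (simp_all add: labels_def labelled_def)

lemma set_labels: "set (labels w) = {(b, i). 1 \<le> i \<and> i \<le> count_list w b}"
  by (induction w rule: rev_induct) (auto simp: labels_snoc split: if_splits)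

lemma sorted_labels: "sorted_wrt (\<lambda>x y. fst x = fst y \<longrightarrow> snd x < snd y) (labels w)"
  by (induction w rule: rev_induct) (auto simp: labels_snoc sorted_wrt_append set_labels)

lemma distinct_labels: "distinct (labels w)"
  by (induction w rule: rev_induct) (auto simp: labels_snoc set_labels)

text \<open>Occurrences are counted from the left, so the number of a letter depends only on the
  copies before it, and exchanging two different neighbours changes no label. Induction appends on
  the right, where no earlier label is affected.\<close>

lemma labels_swap:
  assumes "a \<noteq> c"
  obtains i j ys where "labels (p @ [a, c] @ s) = labels p @ [(a, i), (c, j)] @ ys"
    and "labels (p @ [c, a] @ s) = labels p @ [(c, j), (a, i)] @ ys"
proof -
  have "\<exists>ys. labels (p @ [a, c] @ s) = labels p @ [(a, Suc (count_list p a)), (c, Suc (count_list p c))] @ ys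
    \<and> labels (p @ [c, a] @ s) = labels p @ [(c, Suc (count_list p c)), (a, Suc (count_list p a))] @ ys"
  proof (induction s rule: rev_induct)
    case Nil
    show ?case using assms labels_snoc[of "p @ [a]" c] labels_snoc[of "p @ [c]" a] by (simp add: labels_snoc)
  next
    case (snoc x s)
    then show ?case using labels_snoc[of "p @ [a, c] @ s" x] labels_snoc[of "p @ [c, a] @ s" x] by auto
  qed
  then show ?thesis using that by blast
qed

lemma word_coinv_labels:
  "word_coinv w = {(x, y). fst x < fst y \<and> precedes (labels w) y x}"
  by (force simp: word_coinv_def precedes_iff_nth labels_nth)

section \<open>The metasylvester rewriting system\<close>

text \<open>Newman's lemma. The local peak at x closes at u; the induction hypothesis at
  \<open>y'\<close> joins y with u, and then the one at \<open>z'\<close> joins the result with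
  z.\<close>

lemma newman:
  assumes wf: "wfp r\<inverse>\<inverse>"
    and loc: "\<And>x y z. r x y \<Longrightarrow> r x z \<Longrightarrow> \<exists>u. r\<^sup>*\<^sup>* y u \<and> r\<^sup>*\<^sup>* z u"
  shows "confluentp r"
proof (rule confluentpI)
  fix x y z
  assume "r\<^sup>*\<^sup>* x y" "r\<^sup>*\<^sup>* x z"
  with wf show "\<exists>u. r\<^sup>*\<^sup>* y u \<and> r\<^sup>*\<^sup>* z u"
  proof (induction x arbitrary: y z rule: wfp_induct_rule)
    case (less x)
    show ?case
    proof (cases "x = y \<or> x = z")
      case True
      then show ?thesis using less.prems by auto
    next
      case False
      then obtain y' z' where y': "r x y'" "r\<^sup>*\<^sup>* y' y" and z': "r x z'" "r\<^sup>*\<^sup>* z' z"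
        using less.prems by (metis converse_rtranclpE)
      obtain u where u: "r\<^sup>*\<^sup>* y' u" "r\<^sup>*\<^sup>* z' u" using loc y'(1) z'(1) by blast
      obtain v where v: "r\<^sup>*\<^sup>* y v" "r\<^sup>*\<^sup>* u v" using less.IH y' u(1) by blast
      have "r\<^sup>*\<^sup>* z' v" using u(2) v(2) by (rule rtranclp_trans)
      then obtain t where "r\<^sup>*\<^sup>* v t" "r\<^sup>*\<^sup>* z t" using less.IH z' by blast
      then show ?thesis using v(1) by (meson rtranclp_trans)
    qed
  qed
qed

text \<open>The two generating relations become one: \<open>b = a\<close> is the first, \<open>a < b\<close> the second.\<close>

lemma metasylv_step_iff:
  "metasylv_step x y \<longleftrightarrow>
    (\<exists>p a c s. x = p @ [a, c] @ s \<and> y = p @ [c, a] @ s \<and>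
      (\<exists>b\<in>set s. a \<le> b \<and> b < c \<and> (b = a \<or> b \<in> set p)))" (is "_ \<longleftrightarrow> ?R")
proof
  assume "metasylv_step x y"
  then show ?R
  proof cases
    case (1 a c u v w)
    then show ?thesis
      by (intro exI[of _ u] exI[of _ a] exI[of _ c] exI[of _ "v @ [a] @ w"]) auto
  next
    case (2 a b c u v w z)
    then show ?thesis
      by (intro exI[of _ "u @ [b] @ v"] exI[of _ a] exI[of _ c] exI[of _ "w @ [b] @ z"]) auto
  qed
next
  assume ?R
  then obtain p a c s b where *: "x = p @ [a, c] @ s" "y = p @ [c, a] @ s"
    "b \<in> set s" "a \<le> b" "b < c" "b = a \<or> b \<in> set p" by blast
  obtain s1 s2 where s: "s = s1 @ b # s2" using *(3) by (auto simp: in_set_conv_decomp)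
  show "metasylv_step x y"
  proof (cases "b = a")
    case True
    then show ?thesis using metasylv_step.intros(1)[of a c p s1 s2] * s by simp
  next
    case False
    then obtain p1 p2 where "p = p1 @ b # p2" using * by (auto simp: in_set_conv_decomp)
    then show ?thesis using metasylv_step.intros(2)[of a b c p1 p2 s1 s2] * s False by simp
  qed
qed

lemma metasylv_stepI:
  "b \<in> set s \<Longrightarrow> a \<le> b \<Longrightarrow> b < c \<Longrightarrow> b = a \<or> b \<in> set p \<Longrightarrow>
    metasylv_step (p @ a # c # s) (p @ c # a # s)"
  unfolding metasylv_step_iff by fastforce

text \<open>Only the two exchanged labelled letters change their relative order, and they turn from
  a non-inversion into a co-inversion.\<close>

lemma word_coinv_step: "metasylv_step x y \<Longrightarrow> word_coinv x \<subset> word_coinv y"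
proof -
  assume "metasylv_step x y"
  then obtain p a c s where x: "x = p @ [a, c] @ s" and y: "y = p @ [c, a] @ s" and ac: "a < c"
    unfolding metasylv_step_iff by force
  obtain i j ys where lx: "labels x = labels p @ [(a, i), (c, j)] @ ys"
    and ly: "labels y = labels p @ [(c, j), (a, i)] @ ys"
    using labels_swap[of a c p s] ac unfolding x y by auto
  have "word_coinv x \<subseteq> word_coinv y"
    unfolding word_coinv_labels lx ly using ac by (auto simp: precedes_append)
  moreover have "((a, i), (c, j)) \<in> word_coinv y"
    unfolding word_coinv_labels ly using ac by (auto simp: precedes_append)
  moreover have "((a, i), (c, j)) \<notin> word_coinv x"
    using distinct_labels[of x] unfolding word_coinv_labels lx using ac
    by (auto simp: precedes_append dest: precedes_in_set)
  ultimately show ?thesis by blast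
qed

section \<open>Termination and local confluence\<close>

text \<open>This is the sum of the letters, each multiplied by its 0-based position. Moving the
  larger of two neighbours one place to the left lowers it by their difference.\<close>

primrec weight :: "nat list \<Rightarrow> nat" where
  "weight [] = 0"
| "weight (x # xs) = sum_list xs + weight xs"

lemma weight_swap: "a < c \<Longrightarrow> weight (p @ [c, a] @ s) < weight (p @ [a, c] @ s)"
  by (induction p) auto

lemma weight_step: "metasylv_step x y \<Longrightarrow> weight y < weight x"
  unfolding metasylv_step_iff using weight_swap le_less_trans by blast

text \<open>Two exchanged pairs coincide, share one letter, or are disjoint. Disjoint exchanges
  commute, since an exchange does not alter which letters stand before or after another pair. A
  shared letter gives a factor a c c' with a < c < c', and both sides reduce to its reversal c' c
  a.\<close>

lemma local_confluence_ordered: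
  assumes "p @ [a, c] @ s = p' @ [a', c'] @ s'" and len: "length p \<le> length p'"
    and b: "b \<in> set s" "a \<le> b" "b < c" "b = a \<or> b \<in> set p"
    and b': "b' \<in> set s'" "a' \<le> b'" "b' < c'" "b' = a' \<or> b' \<in> set p'"
  shows "\<exists>u. metasylv_step\<^sup>*\<^sup>* (p @ [c, a] @ s) u \<and> metasylv_step\<^sup>*\<^sup>* (p' @ [c', a'] @ s') u"
proof -
  obtain q where q: "p' = p @ q" and eq: "[a, c] @ s = q @ [a', c'] @ s'"
    using assms(1) len by (auto simp: append_eq_append_conv2)
  consider "q = []" | "q = [a]" | t where "q = a # c # t"
    using eq by (cases q; cases "tl q") auto
  then show ?thesis
  proof cases
    case 1
    then show ?thesis using q eq by auto
  next
    case 2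
    then have *: "p' = p @ [a]" "a' = c" "s = c' # s'" using q eq by auto
    \<comment> \<open>The witnesses survive the reordering: b < c < c' forces \<open>b\<close> to
      lie behind \<open>c'\<close>, and \<open>b' \<ge> c > a\<close> forces \<open>b'\<close> to be
      \<open>c\<close> or to lie in \<open>p\<close>. Below, \<open>b\<close> licenses every
      exchange that moves \<open>a\<close>, and \<open>b'\<close> the exchange of \<open>c\<close>
      and \<open>c'\<close>.\<close>
    have bs: "b \<in> set s'" using b b' * by auto
    have b's: "b' = c \<or> b' \<in> set p" using b' b * by auto
    let ?u = "p @ [c', c, a] @ s'"
    have "metasylv_step (p @ [c, a, c'] @ s') (p @ [c, c', a] @ s')"
      using metasylv_stepI[of b s' a c' "p @ [c]"] b b' bs * by auto
    moreover have "metasylv_step (p @ [c, c', a] @ s') ?u"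
      using metasylv_stepI[of b' "a # s'" c c' p] b b' b's * by auto
    moreover have "metasylv_step (p @ [a, c', c] @ s') (p @ [c', a, c] @ s')"
      using metasylv_stepI[of b "c # s'" a c' p] b b' bs * by auto
    moreover have "metasylv_step (p @ [c', a, c] @ s') ?u"
      using metasylv_stepI[of b s' a c "p @ [c']"] b b' bs * by auto
    ultimately show ?thesis unfolding * by (intro exI[of _ ?u]) (auto intro: converse_rtranclp_into_rtranclp)
  next
    case 3
    then have *: "p' = p @ [a, c] @ t" "s = t @ [a', c'] @ s'" using q eq by auto
    let ?u = "p @ [c, a] @ t @ [c', a'] @ s'"
    have "metasylv_step (p @ [c, a] @ t @ [a', c'] @ s') ?u"
      using metasylv_stepI[of b' s' a' c' "p @ [c, a] @ t"] b' * by auto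
    moreover have "metasylv_step (p @ [a, c] @ t @ [c', a'] @ s') ?u"
      using metasylv_stepI[of b "t @ [c', a'] @ s'" a c p] b * by auto
    ultimately show ?thesis unfolding * by (intro exI[of _ ?u]) auto
  qed
qed

lemma metasylv_step_local_confluence:
  assumes "metasylv_step x y" and "metasylv_step x z"
  shows "\<exists>u. metasylv_step\<^sup>*\<^sup>* y u \<and> metasylv_step\<^sup>*\<^sup>* z u"
proof -
  obtain p a c s b where 1: "x = p @ [a, c] @ s" "y = p @ [c, a] @ s"
    "b \<in> set s" "a \<le> b" "b < c" "b = a \<or> b \<in> set p"
    using assms(1) unfolding metasylv_step_iff by blast
  obtain p' a' c' s' b' where 2: "x = p' @ [a', c'] @ s'" "z = p' @ [c', a'] @ s'"
    "b' \<in> set s'" "a' \<le> b'" "b' < c'" "b' = a' \<or> b' \<in> set p'"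
    using assms(2) unfolding metasylv_step_iff by blast
  show ?thesis
  proof (cases "length p \<le> length p'")
    case True
    show ?thesis using local_confluence_ordered[OF _ True 1(3-6) 2(3-6)] 1(1,2) 2(1,2) by simp
  next
    case False
    then have "length p' \<le> length p" by simp
    from local_confluence_ordered[OF _ this 2(3-6) 1(3-6)] show ?thesis using 1(1,2) 2(1,2) by auto
  qed
qed

section \<open>Normal forms and maximal elements of classes\<close>

definition avoids_aba :: "nat list \<Rightarrow> bool" where
  "avoids_aba w \<longleftrightarrow>
    \<not> (\<exists>p q r. p < q \<and> q < r \<and> r < length w \<and> w ! p = w ! r \<and> w ! p < w ! q)"

text \<open>A step exchanging a c with witness b exhibits b c b, whose left b is either a letter of
  the prefix or the letter a itself. Conversely, an occurrence of aba with its first two positions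
  as close as possible contains an exchangeable pair; the induction on \<open>q - p\<close> finds
  this closest occurrence.\<close>

lemma irreducible_iff_avoids_aba: "(\<forall>v. \<not> metasylv_step w v) \<longleftrightarrow> avoids_aba w"
proof
  assume av: "avoids_aba w"
  show "\<forall>v. \<not> metasylv_step w v"
  proof (intro allI notI)
    fix v assume "metasylv_step w v"
    then obtain p a c s b where w: "w = p @ [a, c] @ s" and b: "b \<in> set s" "a \<le> b" "b < c"
        "b = a \<or> b \<in> set p"
      unfolding metasylv_step_iff by blast
    obtain r where r: "r < length s" "s ! r = b" using b by (auto simp: in_set_conv_nth)
    obtain k where k: "k \<le> length p" "w ! k = b"
    proof (cases "b = a")
      case True
      then show ?thesis using that[of "length p"] w by simp
    next
      case False
      then obtain k where "k < length p" "p ! k = b" using b by (auto simp: in_set_conv_nth)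
      then show ?thesis using that[of k] w by (simp add: nth_append)
    qed
    have "w ! (length p + 1) = c" "w ! (length p + 2 + r) = b" "length p + 2 + r < length w"
      using w r by (auto simp: nth_append)
    moreover have "k < length p + 1" "length p + 1 < length p + 2 + r" using k by auto
    ultimately show False using av b(3) k(2) unfolding avoids_aba_def by metis
  qed
next
  assume irr: "\<forall>v. \<not> metasylv_step w v"
  have False if "p < q" "q < r" "r < length w" "w ! p = w ! r" "w ! p < w ! q" for p q r
    using that
  proof (induction "q - p" arbitrary: p q rule: less_induct)
    case less
    show False
    proof (cases "\<exists>s. p < s \<and> s < q \<and> w ! p \<le> w ! s")
      case True
      then obtain s where s: "p < s" "s < q" "w ! p \<le> w ! s" by blast
      show False
      proof (cases "w ! s = w ! p")
        case True
        then show False using less.hyps[of q s] less.prems s diff_less_mono2[of p s q] by simp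
      next
        case False
        then show False using less.hyps[of s p] less.prems s diff_less_mono[of s q p] by simp
      qed
    next
      case False
      \<comment> \<open>All letters strictly between positions \<open>p\<close> and \<open>q\<close>
        are now smaller than \<open>w ! p\<close>. Hence the letters at \<open>k\<close> and
        \<open>q\<close> can be exchanged with witness \<open>w ! p\<close>, whose right copy is at
        \<open>r\<close>; for \<open>k = p\<close> this is the first generating relation, otherwise
        the second.\<close>
      define k where "k = q - 1"
      have k: "Suc k = q" "p \<le> k" using less.prems by (auto simp: k_def)
      have split: "w = take k w @ w ! k # w ! q # drop (Suc q) w"
        using k less.prems by (metis Cons_nth_drop_Suc Suc_lessD append_take_drop_id less_trans)
      have "w ! r \<in> set (drop (Suc q) w)"
        using less.prems by (auto simp: in_set_conv_nth intro!: exI[of _ "r - Suc q"])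
      moreover have "w ! k \<le> w ! p" using False k less.prems
        by (metis lessI linorder_not_le nat_less_le order_less_imp_le)
      moreover have "w ! p = w ! k \<or> w ! p \<in> set (take k w)"
        using k less.prems by (cases "p = k") (auto simp: in_set_conv_nth intro!: exI[of _ p])
      ultimately have "metasylv_step (take k w @ w ! k # w ! q # drop (Suc q) w)
          (take k w @ w ! q # w ! k # drop (Suc q) w)"
        using less.prems by (intro metasylv_stepI[of "w ! p"]) auto
      then show False using irr split by metis
    qed
  qed
  then show "avoids_aba w" unfolding avoids_aba_def by blast
qed

text \<open>This is the relation whose equivalence closure occurs in \<open>metasylv_cong\<close>,
  so that confluence applies to the congruence itself.\<close>

definition mperm_step :: "nat \<Rightarrow> nat \<Rightarrow> nat list \<Rightarrow> nat list \<Rightarrow> bool" where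
  "mperm_step n m x y \<longleftrightarrow> x \<in> mperms n m \<and> y \<in> mperms n m \<and> metasylv_step x y"

lemma mperms_step: "metasylv_step x y \<Longrightarrow> x \<in> mperms n m \<Longrightarrow> y \<in> mperms n m"
  unfolding metasylv_step_iff mperms_def
  by (elim exE conjE) (simp add: add_mset_commute del: upt_Suc)

lemma mperm_step_rtranclp:
  "metasylv_step\<^sup>*\<^sup>* x y \<Longrightarrow> x \<in> mperms n m \<Longrightarrow> (mperm_step n m)\<^sup>*\<^sup>* x y \<and> y \<in> mperms n m"
proof (induction rule: rtranclp_induct)
  case (step y z)
  then have "mperm_step n m y z" using mperms_step by (simp add: mperm_step_def)
  then show ?case using step by (auto simp: mperm_step_def intro: rtranclp.rtrancl_into_rtrancl)
qed simp

lemma wfp_mperm_step: "wfp (mperm_step n m)\<inverse>\<inverse>"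
  by (rule wfp_if_convertible_to_nat[where f = weight]) (auto simp: mperm_step_def weight_step)

lemma confluentp_mperm_step: "confluentp (mperm_step n m)"
proof (rule newman[OF wfp_mperm_step])
  fix x y z assume *: "mperm_step n m x y" "mperm_step n m x z"
  then obtain u where "metasylv_step\<^sup>*\<^sup>* y u" "metasylv_step\<^sup>*\<^sup>* z u"
    using metasylv_step_local_confluence unfolding mperm_step_def by blast
  then show "\<exists>u. (mperm_step n m)\<^sup>*\<^sup>* y u \<and> (mperm_step n m)\<^sup>*\<^sup>* z u"
    using * mperm_step_rtranclp unfolding mperm_step_def by meson
qed

lemma mperm_step_normal_form:
  "x \<in> mperms n m \<Longrightarrow> \<exists>w. (mperm_step n m)\<^sup>*\<^sup>* x w \<and> w \<in> mperms n m \<and> avoids_aba w"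
proof (induction x rule: wfp_induct_rule[OF wfp_mperm_step[of n m]])
  case (1 x)
  show ?case
  proof (cases "avoids_aba x")
    case True
    then show ?thesis using 1 by blast
  next
    case False
    then obtain y where "metasylv_step x y" using irreducible_iff_avoids_aba by blast
    then have "mperm_step n m x y" using 1(2) mperms_step by (simp add: mperm_step_def)
    then show ?thesis using 1(1)[of y]
      by (metis conversep_iff converse_rtranclp_into_rtranclp mperm_step_def)
  qed
qed

lemma word_coinv_rtranclp:
  "(mperm_step n m)\<^sup>*\<^sup>* x y \<Longrightarrow> x = y \<or> word_coinv x \<subset> word_coinv y"
  by (induction rule: rtranclp_induct) (auto simp: mperm_step_def dest: word_coinv_step)

lemma metasylv_cong_eq:
  "metasylv_cong n m =
    {(u, v). u \<in> mperms n m \<and> v \<in> mperms n m \<and> equivclp (mperm_step n m) u v}"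
  unfolding metasylv_cong_def mperm_step_def[abs_def] by simp

text \<open>By confluence, congruent words have a common reduct, and an irreducible word has no
  reduct but itself.\<close>

lemma cong_avoids_aba_rtranclp:
  assumes "(x, w) \<in> metasylv_cong n m" and "avoids_aba w"
  shows "(mperm_step n m)\<^sup>*\<^sup>* x w"
proof -
  have "equivclp (mperm_step n m) x w" using assms by (simp add: metasylv_cong_eq)
  then obtain u where "(mperm_step n m)\<^sup>*\<^sup>* x u" "(mperm_step n m)\<^sup>*\<^sup>* w u"
    using semiconfluentp_equivclp[of "mperm_step n m"] confluentp_mperm_step
    by (metis confluentp_eq_semiconfluentp relcomppE rtranclp_conversep conversep_iff)
  moreover have "w = u" using \<open>(mperm_step n m)\<^sup>*\<^sup>* w u\<close> assms(2) irreducible_iff_avoids_aba[of w]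
    by (metis converse_rtranclpE mperm_step_def)
  ultimately show ?thesis by simp
qed

text \<open>Every word of the class reduces to \<open>w\<close> and each step adds co-inversions, so
  \<open>w\<close> lies strictly above all other elements of the class.\<close>

lemma is_maximal_in_iff:
  assumes C: "C \<in> metasylv_classes n m" and w: "w \<in> C" "avoids_aba w"
  shows "is_maximal_in C v \<longleftrightarrow> v = w"
proof -
  have steps: "(mperm_step n m)\<^sup>*\<^sup>* x w" if "x \<in> C" for x
    using that C w cong_avoids_aba_rtranclp quotient_eq_iff[OF equiv_metasylv_cong]
    unfolding metasylv_classes_def by blast
  show ?thesis
    using steps[THEN word_coinv_rtranclp] w unfolding is_maximal_in_def word_le_def by blast
qed

lemma max_elem_eq:
  "C \<in> metasylv_classes n m \<Longrightarrow> w \<in> C \<Longrightarrow> avoids_aba w \<Longrightarrow> max_elem C = w"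
  unfolding max_elem_def by (rule the_equality) (simp_all add: is_maximal_in_iff)

lemma class_has_avoids_aba:
  assumes "C \<in> metasylv_classes n m"
  obtains w where "w \<in> C" "w \<in> mperms n m" "avoids_aba w"
proof -
  obtain x where x: "x \<in> mperms n m" "C = metasylv_cong n m `` {x}"
    using assms unfolding metasylv_classes_def by (auto elim: quotientE)
  obtain w where w: "(mperm_step n m)\<^sup>*\<^sup>* x w" "w \<in> mperms n m" "avoids_aba w"
    using mperm_step_normal_form x(1) by blast
  have "equivclp (mperm_step n m) x w" using rtranlcp_le_equivclp w(1) by (metis predicate2D)
  then show ?thesis using that w x by (simp add: metasylv_cong_eq)
qed

lemma classes_eqI:
  assumes "C \<in> metasylv_classes n m" "D \<in> metasylv_classes n m" "w \<in> C" "w \<in> D"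
  shows "C = D"
  using assms quotient_disj[OF equiv_metasylv_cong] unfolding metasylv_classes_def by blast

lemma ex_class:
  assumes "w \<in> mperms n m"
  obtains C where "C \<in> metasylv_classes n m" "w \<in> C"
  using assms equiv_class_self[OF equiv_metasylv_cong] that
  unfolding metasylv_classes_def by (meson quotientI)

section \<open>Words avoiding aba and their tree-inversions\<close>

lemma avoids_aba_iff_labels:
  "avoids_aba w \<longleftrightarrow>
    (\<forall>x y z. precedes (labels w) x y \<longrightarrow> precedes (labels w) y z \<longrightarrow> fst x = fst z \<longrightarrow> fst y \<le> fst x)"
proof (intro iffI allI impI)
  fix x y z
  assume av: "avoids_aba w" and xy: "precedes (labels w) x y" and yz: "precedes (labels w) y z"
    and eq: "fst x = fst z"
  obtain p q where pq: "p < q" "q < length w" "labels w ! p = x" "labels w ! q = y"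
    using xy by (auto simp: precedes_iff_nth)
  obtain q' r where qr: "q' < r" "r < length w" "labels w ! q' = y" "labels w ! r = z"
    using yz by (auto simp: precedes_iff_nth)
  \<comment> \<open>The two relations give two positions for \<open>y\<close>; they agree because
    labels do not repeat.\<close>
  have "q' = q" using nth_eq_iff_index_eq[OF distinct_labels[of w], of q' q] pq qr by simp
  moreover have "w ! p = fst x" "w ! q = fst y" "w ! r = fst z"
    using pq qr by (auto simp: labels_nth labelled_def)
  ultimately show "fst y \<le> fst x" using av pq qr eq unfolding avoids_aba_def
    by (metis linorder_not_le)
next
  assume *: "\<forall>x y z. precedes (labels w) x y \<longrightarrow> precedes (labels w) y z \<longrightarrow> fst x = fst z \<longrightarrow>
    fst y \<le> fst x"
  have fst_nth: "fst (labels w ! p) = w ! p" if "p < length w" for p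
    using that by (simp add: labels_nth labelled_def)
  show "avoids_aba w"
    unfolding avoids_aba_def
  proof (intro notI, elim exE conjE)
    fix p q r assume pqr: "p < q" "q < r" "r < length w" "w ! p = w ! r" "w ! p < w ! q"
    have "precedes (labels w) (labels w ! p) (labels w ! q)"
      "precedes (labels w) (labels w ! q) (labels w ! r)"
      unfolding precedes_iff_nth using pqr by (metis length_labels less_trans)+
    then have "fst (labels w ! q) \<le> fst (labels w ! p)" 
      using *[rule_format, of "labels w ! p" "labels w ! q" "labels w ! r"] pqr fst_nth[of p] fst_nth[of r]
      by simp
    then have "w ! q \<le> w ! p" using pqr fst_nth by simp
    then show False using pqr by simp
  qed
qed

text \<open>This recognises the lists that are label lists of words: every labelled letter is
  preceded by all copies of smaller number. If \<open>(b, j)\<close> is last, then the numbers 1 to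
  j - 1 of b occurred before and j did not, which makes j the next count.\<close>

lemma labels_map_fst:
  "distinct xs \<Longrightarrow>
    (\<And>b i j. (b, j) \<in> set xs \<Longrightarrow> 1 \<le> j \<and> (1 \<le> i \<longrightarrow> i < j \<longrightarrow> precedes xs (b, i) (b, j))) \<Longrightarrow>
    labels (map fst xs) = xs"
proof (induction xs rule: rev_induct)
  case Nil
  show ?case by simp
next
  case (snoc x xs)
  obtain b j where x: "x = (b, j)" by (cases x)
  have IH: "labels (map fst xs) = xs"
  proof (rule snoc.IH)
    show "distinct xs" using snoc.prems(1) by simp
    fix a i k assume ak: "(a, k) \<in> set xs"
    have "(a, k) \<noteq> x" using ak snoc.prems(1) by auto
    moreover have "1 \<le> k \<and> (1 \<le> i \<longrightarrow> i < k \<longrightarrow> precedes (xs @ [x]) (a, i) (a, k))"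
      by (rule snoc.prems(2)) (simp add: ak)
    ultimately show "1 \<le> k \<and> (1 \<le> i \<longrightarrow> i < k \<longrightarrow> precedes xs (a, i) (a, k))"
      by (simp add: precedes_append)
  qed
  have mem: "(b, i) \<in> set xs \<longleftrightarrow> 1 \<le> i \<and> i \<le> count_list (map fst xs) b" for i
  proof -
    have "(b, i) \<in> set (labels (map fst xs)) \<longleftrightarrow> 1 \<le> i \<and> i \<le> count_list (map fst xs) b"
      by (simp add: set_labels)
    then show ?thesis by (simp add: IH)
  qed
  have new: "1 \<le> j \<and> (1 \<le> i \<longrightarrow> i < j \<longrightarrow> precedes (xs @ [x]) (b, i) (b, j))" for i
    by (rule snoc.prems(2)) (simp add: x)
  have j: "1 \<le> j" "(b, j) \<notin> set xs" using snoc.prems(1) new x by simp_all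
  have prev: "(b, i) \<in> set xs" if "1 \<le> i" "i < j" for i
    using new[of i] that j(2) by (auto simp: precedes_append dest: precedes_in_set)
  \<comment> \<open>For \<open>j = 1\<close> the bound reads 0; there is no label with number 0 to
    appeal to, hence the case distinction.\<close>
  have "j - 1 \<le> count_list (map fst xs) b"
    using mem[of "j - 1"] prev[of "j - 1"] by (cases "j \<le> 1") simp_all
  then have "j = Suc (count_list (map fst xs) b)" using j mem[of j] by auto
  then show ?case using labels_snoc[of "map fst xs" b] by (simp add: IH x)
qed

section \<open>The order of labelled letters determined by tree-inversions\<close>

lemma mperms_iff:
  "w \<in> mperms n m \<longleftrightarrow> (\<forall>b. count_list w b = (if b \<in> {1..n} then m else 0))"
proof -
  have "count (mset (concat (map (replicate m) [1..<Suc n]))) b = (if b \<in> {1..n} then m else 0)" for b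
    by (induction n) auto
  then show ?thesis unfolding mperms_def multiset_eq_iff by (simp del: upt_Suc add: count_mset)
qed

lemma set_labels_mperms:
  assumes "w \<in> mperms n m"
  shows "set (labels w) = {1..n} \<times> {1..m}"
  using assms unfolding set_labels mperms_iff by (auto split: if_splits)

text \<open>The order of the labelled letters in the word whose set of tree-inversions is \<open>T\<close>.\<close>

definition tree_less :: "(nat \<times> nat \<times> nat) set \<Rightarrow> nat \<times> nat \<Rightarrow> nat \<times> nat \<Rightarrow> bool" where
  "tree_less T x y \<longleftrightarrow> fst x = fst y \<and> snd x < snd y \<or> fst x < fst y \<and> (fst x, y) \<notin> T \<or>
    fst y < fst x \<and> (fst y, x) \<in> T"

lemma tree_less_asym: "tree_less T x y \<Longrightarrow> \<not> tree_less T y x"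
  by (auto simp: tree_less_def)

lemma tree_less_total: "x \<noteq> y \<Longrightarrow> tree_less T x y \<or> tree_less T y x"
  unfolding tree_less_def by (metis linorder_neqE_nat prod_eqI)

text \<open>All copies of \<open>a\<close> lie after \<open>x\<close> iff the first copy does.\<close>

definition tree_inv :: "nat list \<Rightarrow> (nat \<times> nat \<times> nat) set" where
  "tree_inv w = {(a, x). a < fst x \<and> precedes (labels w) x (a, 1)}"

lemma tree_inv_range:
  "w \<in> mperms n m \<Longrightarrow> (a, b, i) \<in> tree_inv w \<Longrightarrow> 1 \<le> a \<and> a < b \<and> b \<le> n \<and> 1 \<le> i \<and> i \<le> m"
  by (auto simp: tree_inv_def set_labels_mperms dest!: precedes_in_set)

lemma first_precedes:
  assumes "(a, k) \<in> set (labels w)" "k \<noteq> 1"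
  shows "precedes (labels w) (a, 1) (a, k)"
proof -
  have k: "1 < k" and "(a, 1) \<in> set (labels w)" using assms by (auto simp: set_labels)
  then have "precedes (labels w) (a, 1) (a, k) \<or> precedes (labels w) (a, k) (a, 1)"
    using assms precedes_total by force
  then show ?thesis using sorted_wrt_precedesD[OF sorted_labels, of w "(a, k)" "(a, 1)"] k by auto
qed

lemma precedes_first:
  assumes "w \<in> mperms n m" "1 \<le> m" "precedes (labels w) x (a, 1)" "1 \<le> k" "k \<le> m"
  shows "precedes (labels w) x (a, k)"
proof (cases "k = 1")
  case False
  have "a \<in> {1..n}" using precedes_in_set[OF assms(3)] assms(1) by (auto simp: set_labels_mperms)
  then show ?thesis using first_precedes[of a k w] False assms distinct_labels
    by (auto simp: set_labels_mperms intro: precedes_trans)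
qed (use assms in simp)

text \<open>If the larger letter \<open>x\<close> comes before \<open>y\<close>, it must come before
  every copy of the letter of \<open>y\<close>: otherwise it would stand between the first copy and
  \<open>y\<close>, an aba. If the smaller letter \<open>x\<close> comes first, then the larger
  \<open>y\<close> cannot precede the first copy of the letter of \<open>x\<close>.\<close>

lemma precedes_tree_less:
  assumes w: "w \<in> mperms n m" "avoids_aba w" and xy: "precedes (labels w) x y"
  shows "tree_less (tree_inv w) x y"
proof -
  have mem: "x \<in> set (labels w)" "y \<in> set (labels w)" using precedes_in_set[OF xy] by auto
  consider "fst x = fst y" | "fst x < fst y" | "fst y < fst x" by linarith
  then show ?thesis
  proof cases
    case 1
    then show ?thesis using sorted_wrt_precedesD[OF sorted_labels xy] by (simp add: tree_less_def)
  next
    case 2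
    have "\<not> precedes (labels w) y (fst x, 1)"
    proof
      assume "precedes (labels w) y (fst x, 1)"
      with xy have "precedes (labels w) x (fst x, 1)" using distinct_labels precedes_trans by metis
      then have "snd x < 1" using sorted_wrt_precedesD[OF sorted_labels] by fastforce
      then show False using mem by (auto simp: set_labels)
    qed
    then show ?thesis using 2 by (simp add: tree_less_def tree_inv_def)
  next
    case 3
    have "precedes (labels w) x (fst y, 1)"
    proof (rule ccontr)
      assume *: "\<not> precedes (labels w) x (fst y, 1)"
      then have "snd y \<noteq> 1" using xy by (metis prod.collapse)
      then have fy: "precedes (labels w) (fst y, 1) y" using first_precedes[of "fst y" "snd y" w] mem by simp
      then have "precedes (labels w) (fst y, 1) x"
        using * 3 precedes_total[of x "labels w" "(fst y, 1)"] precedes_in_set[OF fy] mem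
        by (metis fst_conv less_irrefl)
      then have "fst x \<le> fst y" using w(2) xy unfolding avoids_aba_iff_labels by fastforce
      then show False using 3 by simp
    qed
    then show ?thesis using 3 by (simp add: tree_less_def tree_inv_def)
  qed
qed

lemma tree_less_iff_precedes:
  assumes "w \<in> mperms n m" "avoids_aba w" "x \<in> {1..n} \<times> {1..m}" "y \<in> {1..n} \<times> {1..m}"
  shows "tree_less (tree_inv w) x y \<longleftrightarrow> precedes (labels w) x y"
  using assms precedes_tree_less[OF assms(1,2)] precedes_total[of x "labels w" y] tree_less_asym
  by (metis set_labels_mperms)

text \<open>Both label lists sort the same set by the same asymmetric relation.\<close>

lemma tree_inv_inj:
  assumes "w \<in> mperms n m" "avoids_aba w" "v \<in> mperms n m" "avoids_aba v" "tree_inv w = tree_inv v"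
  shows "w = v"
proof -
  have "sorted_wrt (tree_less (tree_inv w)) (labels w)" "sorted_wrt (tree_less (tree_inv w)) (labels v)"
    using sorted_wrt_mono_rel[OF _ sorted_wrt_precedes] precedes_tree_less assms by metis+
  then have "labels w = labels v"
    using sorted_wrt_asymp_unique[of "tree_less (tree_inv w)"] tree_less_asym set_labels_mperms assms
    by metis
  then show ?thesis by (metis map_fst_labels)
qed

text \<open>The word is obtained by sorting all labelled letters by \<open>tree_less T\<close> and
  forgetting the numbers. Copies of one letter are sorted by number, so forgetting loses nothing:
  the sorted list is the label list of the word.\<close>

lemma word_of_tree_less:
  assumes m: "1 \<le> m"
    and range: "\<And>a b i. (a, b, i) \<in> T \<Longrightarrow> 1 \<le> a \<and> a < b \<and> b \<le> n \<and> 1 \<le> i \<and> i \<le> m"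
    and trans: "\<And>x y z. x \<in> {1..n} \<times> {1..m} \<Longrightarrow> y \<in> {1..n} \<times> {1..m} \<Longrightarrow> z \<in> {1..n} \<times> {1..m} \<Longrightarrow>
      tree_less T x y \<Longrightarrow> tree_less T y z \<Longrightarrow> tree_less T x z"
  shows "\<exists>w \<in> mperms n m. avoids_aba w \<and> tree_inv w = T"
proof -
  let ?L = "{1..n} \<times> {1..m}"
  have "\<exists>xs. sorted_wrt (tree_less T) xs \<and> set xs = ?L"
  proof (rule ex_sorted_wrt)
    show "tree_less T x z" if "x \<in> ?L" "y \<in> ?L" "z \<in> ?L" "tree_less T x y" "tree_less T y z" for x y z
      using that by (rule trans)
  qed (simp, rule tree_less_total)
  then obtain xs where xs: "sorted_wrt (tree_less T) xs" "set xs = ?L" by blast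
  have "sorted_wrt (\<noteq>) xs"
    by (rule sorted_wrt_mono_rel[OF _ xs(1)]) (use tree_less_asym in blast)
  then have dist: "distinct xs" by (induction xs) auto
  have prec: "precedes xs x y \<longleftrightarrow> tree_less T x y" if "x \<in> ?L" "y \<in> ?L" for x y
    using sorted_wrt_precedesD[OF xs(1)] precedes_total[of x xs y] xs(2) that tree_less_asym by metis
  define w where "w = map fst xs"
  have lab: "labels w = xs" unfolding w_def
  proof (rule labels_map_fst[OF dist])
    fix b i j assume "(b, j) \<in> set xs"
    then have "(b, j) \<in> ?L" using xs(2) by simp
    then show "1 \<le> j \<and> (1 \<le> i \<longrightarrow> i < j \<longrightarrow> precedes xs (b, i) (b, j))"
      using prec[of "(b, i)" "(b, j)"] by (auto simp: tree_less_def)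
  qed
  have mem: "1 \<le> i \<and> i \<le> count_list w b \<longleftrightarrow> b \<in> {1..n} \<and> i \<in> {1..m}" for b i
  proof -
    have "(b, i) \<in> set (labels w) \<longleftrightarrow> b \<in> {1..n} \<and> i \<in> {1..m}" unfolding lab xs(2) by simp
    then show ?thesis by (simp add: set_labels)
  qed
  have "count_list w b = (if b \<in> {1..n} then m else 0)" for b
  proof (cases "b \<in> {1..n}")
    case True
    then have "m \<le> count_list w b" using mem[of m b] m by simp
    \<comment> \<open>The count itself is the number of an existing copy as soon as it is positive,
      so it lies in the allowed range.\<close>
    moreover have "count_list w b \<le> m" using mem[of "count_list w b" b] calculation m by simp
    ultimately show ?thesis using True by simp
  next
    case False
    then have "\<not> 1 \<le> count_list w b" using mem[of "count_list w b" b] by blast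
    then show ?thesis using False by auto
  qed
  then have "w \<in> mperms n m" unfolding mperms_iff by blast
  moreover have "avoids_aba w" unfolding avoids_aba_iff_labels lab
  proof (intro allI impI)
    fix x y z assume *: "precedes xs x y" "precedes xs y z" "fst x = fst z"
    have less: "tree_less T x y" "tree_less T y z"
      using sorted_wrt_precedesD[OF xs(1)] *(1,2) by blast+
    show "fst y \<le> fst x"
    proof (rule ccontr)
      assume lt: "\<not> fst y \<le> fst x"
      \<comment> \<open>With \<open>y\<close> the larger letter, both comparisons consult the same
        triple, since \<open>x\<close> and \<open>z\<close> carry the same letter: one denies its
        membership in \<open>T\<close>, the other asserts it.\<close>
      have "(fst x, y) \<notin> T" using less(1) lt unfolding tree_less_def by linarith
      moreover have "(fst x, y) \<in> T" using less(2) lt unfolding tree_less_def *(3) by linarith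
      ultimately show False by blast
    qed
  qed
  moreover
  have "(a, x) \<in> tree_inv w \<longleftrightarrow> (a, x) \<in> T" for a x
  proof (cases "a < fst x \<and> x \<in> ?L \<and> (a, 1) \<in> ?L")
    case True
    then have "(a, x) \<in> tree_inv w \<longleftrightarrow> tree_less T x (a, 1)"
      using prec[of x "(a, 1)"] by (simp add: tree_inv_def lab)
    then show ?thesis using True by (simp add: tree_less_def)
  next
    case False
    have "(a, x) \<notin> tree_inv w"
      using False precedes_in_set[of xs x "(a, 1)"] unfolding tree_inv_def lab xs(2) by blast
    moreover have "(a, x) \<notin> T"
    proof
      assume "(a, x) \<in> T"
      then show False using False range[of a "fst x" "snd x"] m by (simp add: mem_Times_iff)
    qed
    ultimately show ?thesis by simp
  qed
  then have "tree_inv w = T" by (intro set_eqI) (simp add: split_paired_all)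
  ultimately show ?thesis by blast
qed

lemma tree_inversions_eq:
  assumes w: "w \<in> mperms n m" and m: "1 \<le> m" and max: "max_elem C = w"
  shows "tree_inversions n m C = tree_inv w"
proof -
  have iff: "(\<exists>p<length w. labelled w p = (b, i) \<and> (\<forall>q<length w. w ! q = a \<longrightarrow> p < q)) \<longleftrightarrow>
      precedes (labels w) (b, i) (a, 1)" (is "?l \<longleftrightarrow> ?r")
    if "1 \<le> a" "a < b" "b \<le> n" "1 \<le> i" "i \<le> m" for a b i
  proof
    assume ?l
    then obtain p where p: "p < length w" "labelled w p = (b, i)" "\<forall>q<length w. w ! q = a \<longrightarrow> p < q"
      by blast
    have "(a, 1) \<in> set (labels w)" using that m set_labels_mperms[OF w] by simp
    then obtain q where q: "q < length w" "labels w ! q = (a, 1)" by (auto simp: in_set_conv_nth)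
    then have "w ! q = a" by (simp add: labels_nth labelled_def)
    then show ?r using p q unfolding precedes_iff_nth
      by (intro exI[of _ p] exI[of _ q]) (simp add: labels_nth)
  next
    assume r: ?r
    then obtain p where p: "p < length w" "labels w ! p = (b, i)"
      by (metis precedes_in_set in_set_conv_nth length_labels)
    have "p < q" if q: "q < length w" "w ! q = a" for q
    proof -
      have "labels w ! q \<in> set (labels w)" using q by simp
      moreover have "fst (labels w ! q) = a" using q by (simp add: labels_nth labelled_def)
      ultimately obtain k where k: "labels w ! q = (a, k)" "1 \<le> k" "k \<le> m"
        unfolding set_labels_mperms[OF w] by (cases "labels w ! q") auto
      then have "precedes (labels w) (b, i) (a, k)" using precedes_first[OF w m r] by blast
      then obtain p' q' where *: "p' < q'" "q' < length w" "labels w ! p' = (b, i)" "labels w ! q' = (a, k)"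
        by (auto simp: precedes_iff_nth)
      have "p' = p" "q' = q"
        using * p q k nth_eq_iff_index_eq[OF distinct_labels[of w], of p' p]
          nth_eq_iff_index_eq[OF distinct_labels[of w], of q' q] by simp_all
      then show ?thesis using * by simp
    qed
    then show ?l using p by (auto simp: labels_nth)
  qed
  have "(a, b, i) \<in> tree_inversions n m C \<longleftrightarrow> (a, b, i) \<in> tree_inv w" for a b i
  proof (cases "1 \<le> a \<and> a < b \<and> b \<le> n \<and> 1 \<le> i \<and> i \<le> m")
    case True
    then show ?thesis using iff[of a b i] by (simp add: tree_inversions_def max tree_inv_def)
  next
    case False
    then show ?thesis using tree_inv_range[OF w, of a b i] by (auto simp: tree_inversions_def)
  qed
  then show ?thesis by (intro set_eqI) (simp add: split_paired_all)
qed

section \<open>Chains\<close>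

text \<open>\<open>inv s x\<close> is the position of the letter x in the word s. From here on a
  chain is treated through these position functions.\<close>

lemma coinv_permutes:
  assumes s: "s permutes {1..n}"
  shows "coinv n s = {(a, b). a < b \<and> a \<in> {1..n} \<and> b \<in> {1..n} \<and> inv s b < inv s a}"
proof -
  have "(\<exists>k l. 1 \<le> k \<and> k < l \<and> l \<le> n \<and> s k = b \<and> s l = a) \<longleftrightarrow>
      a \<in> {1..n} \<and> b \<in> {1..n} \<and> inv s b < inv s a" (is "?l \<longleftrightarrow> ?r") for a b
  proof
    assume ?l
    then obtain k l where kl: "1 \<le> k" "k < l" "l \<le> n" "s k = b" "s l = a" by blast
    then have "b \<in> {1..n}" "a \<in> {1..n}"
      using permutes_in_image[OF s, of k] permutes_in_image[OF s, of l] by simp_all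
    moreover have "inv s b = k" "inv s a = l" using kl permutes_inverses(2)[OF s] by blast+
    ultimately show ?r using kl by simp
  next
    assume ?r
    moreover have "inv s x \<in> {1..n} \<longleftrightarrow> x \<in> {1..n}" "s (inv s x) = x" for x
      using permutes_in_image[OF permutes_inv[OF s]] permutes_inverses(1)[OF s] by blast+
    ultimately show ?l by (intro exI[of _ "inv s b"] exI[of _ "inv s a"]) (meson atLeastAtMost_iff)
  qed
  then show ?thesis by (simp add: coinv_def)
qed

text \<open>Places are renamed by the letters x, y, z that stand there in s. In these terms 231
  means that s has the order x y z and t has the order z x y.\<close>

lemma avoids_231_permutes:
  assumes s: "s permutes {1..n}"
  shows "avoids_231 n (inv t \<circ> s) \<longleftrightarrow>
    \<not> (\<exists>x\<in>{1..n}. \<exists>y\<in>{1..n}. \<exists>z\<in>{1..n}. inv s x < inv s y \<and> inv s y < inv s z \<and>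
      inv t z < inv t x \<and> inv t x < inv t y)"
proof -
  have "(\<exists>i j k. 1 \<le> i \<and> i < j \<and> j < k \<and> k \<le> n \<and> inv t (s k) < inv t (s i) \<and> inv t (s i) < inv t (s j))
    \<longleftrightarrow> (\<exists>x\<in>{1..n}. \<exists>y\<in>{1..n}. \<exists>z\<in>{1..n}. inv s x < inv s y \<and> inv s y < inv s z \<and>
      inv t z < inv t x \<and> inv t x < inv t y)" (is "?l \<longleftrightarrow> ?r")
  proof
    assume ?l
    then obtain i j k where *: "1 \<le> i" "i < j" "j < k" "k \<le> n"
      "inv t (s k) < inv t (s i)" "inv t (s i) < inv t (s j)" by blast
    then have "s i \<in> {1..n}" "s j \<in> {1..n}" "s k \<in> {1..n}"
      using permutes_in_image[OF s] by simp_all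
    then show ?r using * permutes_inverses(2)[OF s]
      by (intro bexI[of _ "s i"] bexI[of _ "s j"] bexI[of _ "s k"]) simp_all
  next
    assume ?r
    then obtain x y z where *: "x \<in> {1..n}" "y \<in> {1..n}" "z \<in> {1..n}" "inv s x < inv s y"
      "inv s y < inv s z" "inv t z < inv t x" "inv t x < inv t y" by blast
    have "1 \<le> inv s x" "inv s z \<le> n"
      using * permutes_in_image[OF permutes_inv[OF s]] by (metis atLeastAtMost_iff)+
    then show ?l using * permutes_inverses(1)[OF s]
      by (intro exI[of _ "inv s x"] exI[of _ "inv s y"] exI[of _ "inv s z"]) simp
  qed
  then show ?thesis by (simp add: avoids_231_def)
qed

section \<open>Permutations as linear orders on letters\<close>

text \<open>The value \<open>p x\<close> is a rank, the number of b with
  \<open>p b \<le> p x\<close>. The condition is written as a negated strict inequality so that it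
  is expressed by the comparisons which \<open>p\<close> and \<open>q\<close> share.\<close>

lemma permutes_eqI:
  fixes p q :: "nat \<Rightarrow> nat"
  assumes p: "p permutes {1..n}" and q: "q permutes {1..n}"
    and iff: "\<And>a b. a \<in> {1..n} \<Longrightarrow> b \<in> {1..n} \<Longrightarrow> p a < p b \<longleftrightarrow> q a < q b"
  shows "p = q"
proof
  fix x
  have rank: "p x = card {b \<in> {1..n}. \<not> p x < p b}" if p: "p permutes {1..n}" and x: "x \<in> {1..n}" for p
  proof -
    have "p x \<in> {1..n}" using permutes_in_image[OF p] x by blast
    have "p ` {b \<in> {1..n}. \<not> p x < p b} = {1..p x}"
    proof (intro subset_antisym subsetI)
      fix y assume "y \<in> p ` {b \<in> {1..n}. \<not> p x < p b}"
      then show "y \<in> {1..p x}" using permutes_in_image[OF p] by fastforce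
    next
      fix y assume y: "y \<in> {1..p x}"
      then have "y \<in> {1..n}" using \<open>p x \<in> {1..n}\<close> by simp
      then have "inv p y \<in> {1..n}" using permutes_in_image[OF permutes_inv[OF p]] by blast
      then show "y \<in> p ` {b \<in> {1..n}. \<not> p x < p b}"
        using y permutes_inverses(1)[OF p, of y] by (intro image_eqI[of _ _ "inv p y"]) simp_all
    qed
    moreover have "inj_on p {b \<in> {1..n}. \<not> p x < p b}"
      using permutes_inj[OF p] by (rule inj_on_subset) simp
    ultimately have "card {b \<in> {1..n}. \<not> p x < p b} = card {1..p x}" using card_image by fastforce
    then show ?thesis by simp
  qed
  show "p x = q x"
  proof (cases "x \<in> {1..n}")
    case True
    have "{b \<in> {1..n}. \<not> p x < p b} = {b \<in> {1..n}. \<not> q x < q b}" using iff[OF True] by blast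
    then show ?thesis using rank[OF p True] rank[OF q True] by metis
  next
    case False
    then show ?thesis using permutes_not_in p q by metis
  qed
qed

lemma coinv_inj:
  assumes s: "s permutes {1..n}" and t: "t permutes {1..n}" and eq: "coinv n s = coinv n t"
  shows "s = t"
proof -
  have lt: "inv s b < inv s a \<longleftrightarrow> inv t b < inv t a" if "a \<in> {1..n}" "b \<in> {1..n}" "a < b" for a b
    using that eq unfolding coinv_permutes[OF s] coinv_permutes[OF t] by blast
  have inj: "inv s a \<noteq> inv s b" "inv t a \<noteq> inv t b" if "a \<noteq> b" for a b
    using that permutes_inverses(1)[OF s] permutes_inverses(1)[OF t] by metis+
  have "inv s = inv t"
  proof (rule permutes_eqI[OF permutes_inv[OF s] permutes_inv[OF t]])
    fix a b assume ab: "a \<in> {1..n}" "b \<in> {1..n}"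
    consider "a = b" | "a < b" | "b < a" by linarith
    then show "inv s a < inv s b \<longleftrightarrow> inv t a < inv t b"
    proof cases
      case 2
      then show ?thesis using lt[of a b] ab inj[of a b] by linarith
    next
      case 3
      then show ?thesis using lt[of b a] ab by blast
    qed simp
  qed
  then show ?thesis by (metis permutes_inv_inv s t)
qed

lemma ex_permutes_of_order:
  fixes R :: "nat \<Rightarrow> nat \<Rightarrow> bool"
  assumes asym: "\<And>a b. R a b \<Longrightarrow> \<not> R b a"
    and total: "\<And>a b. a \<in> {1..n} \<Longrightarrow> b \<in> {1..n} \<Longrightarrow> a \<noteq> b \<Longrightarrow> R a b \<or> R b a"
    and trans: "\<And>a b c. a \<in> {1..n} \<Longrightarrow> b \<in> {1..n} \<Longrightarrow> c \<in> {1..n} \<Longrightarrow> R a b \<Longrightarrow> R b c \<Longrightarrow> R a c"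
  shows "\<exists>s. s permutes {1..n} \<and> (\<forall>a\<in>{1..n}. \<forall>b\<in>{1..n}. inv s a < inv s b \<longleftrightarrow> R a b)"
proof -
  let ?B = "\<lambda>a. {b \<in> {1..n}. R b a}"
  \<comment> \<open>The position of a letter is one more than the number of its
    \<open>R\<close>-predecessors; the word itself is then the inverse of \<open>p\<close>.\<close>
  define p where "p a = (if a \<in> {1..n} then Suc (card (?B a)) else a)" for a
  have mono: "p a < p b" if ab: "a \<in> {1..n}" "b \<in> {1..n}" "R a b" for a b
  proof -
    have "?B a \<subseteq> ?B b" using trans[of _ a b] ab by blast
    moreover have "a \<in> ?B b" "a \<notin> ?B a" using ab asym by blast+
    ultimately have "?B a \<subset> ?B b" by blast
    then have "card (?B a) < card (?B b)" by (intro psubset_card_mono) simp_all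
    then show ?thesis using ab by (simp add: p_def)
  qed
  have iff: "p a < p b \<longleftrightarrow> R a b" if "a \<in> {1..n}" "b \<in> {1..n}" for a b
    using mono[of a b] mono[of b a] total[of a b] that by (cases "a = b") (use asym in fastforce)+
  have "inj_on p {1..n}"
  proof (rule inj_onI, rule ccontr)
    fix a b assume "a \<in> {1..n}" "b \<in> {1..n}" "p a = p b" "a \<noteq> b"
    then show False using total[of a b] mono[of a b] mono[of b a] by linarith
  qed
  moreover have "p ` {1..n} \<subseteq> {1..n}"
  proof (rule image_subsetI)
    fix a assume a: "a \<in> {1..n}"
    then have "?B a \<subset> {1..n}" using asym by blast
    then have "card (?B a) < card {1..n}" by (intro psubset_card_mono) simp_all
    then show "p a \<in> {1..n}" using a by (simp add: p_def)
  qed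
  ultimately have "bij_betw p {1..n} {1..n}"
    unfolding bij_betw_def using endo_inj_surj[of "{1..n}" p] by blast
  then have "p permutes {1..n}"
    by (rule bij_imp_permutes) (simp only: p_def if_False)
  then show ?thesis using iff by (intro exI[of _ "inv p"]) (simp add: permutes_inv permutes_inv_inv)
qed

section \<open>The tournament of a chain has no 3-cycle\<close>

text \<open>\<open>P i\<close> stands for the position function of the i-th permutation, so that the
  argument about cycles needs only inequalities between positions.\<close>

definition chain_inv :: "nat \<Rightarrow> nat \<Rightarrow> (nat \<Rightarrow> nat \<Rightarrow> nat) \<Rightarrow> (nat \<times> nat \<times> nat) set" where
  "chain_inv n m P = {(a, b, i). a < b \<and> a \<in> {1..n} \<and> b \<in> {1..n} \<and> i \<in> {1..m} \<and> P i b < P i a}"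

lemma tree_less_chain_inv:
  assumes inj: "\<And>i a b. a \<noteq> b \<Longrightarrow> P i a \<noteq> P i b"
    and mem: "(a, i) \<in> {1..n} \<times> {1..m}" "(b, j) \<in> {1..n} \<times> {1..m}"
  shows "tree_less (chain_inv n m P) (a, i) (b, j) \<longleftrightarrow>
    (if a = b then i < j else if a < b then P j a < P j b else P i a < P i b)"
  using mem inj[of a b j] by (auto simp: tree_less_def chain_inv_def)

text \<open>A cycle through \<open>a_i\<close>, \<open>a_j\<close> with i < j and a smaller letter c
  would invert (c, a) at j but not at i, against the weak order; a larger c would be compared with a
  twice at its own index, with opposite results. For three different letters, rotating the cycle
  puts the largest one last.\<close>

lemma chain_inv_acyclic:
  fixes P :: "nat \<Rightarrow> nat \<Rightarrow> nat" and n m :: nat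
  assumes inj: "\<And>i a b. a \<noteq> b \<Longrightarrow> P i a \<noteq> P i b"
    and mono: "\<And>a b i j. 1 \<le> i \<Longrightarrow> i \<le> j \<Longrightarrow> j \<le> m \<Longrightarrow> a < b \<Longrightarrow> a \<in> {1..n} \<Longrightarrow> b \<in> {1..n} \<Longrightarrow>
      P j b < P j a \<Longrightarrow> P i b < P i a"
    and avoid: "\<And>x y z i j. 1 \<le> i \<Longrightarrow> i < j \<Longrightarrow> j \<le> m \<Longrightarrow> x \<in> {1..n} \<Longrightarrow> y \<in> {1..n} \<Longrightarrow> z \<in> {1..n} \<Longrightarrow>
      P i x < P i y \<Longrightarrow> P i y < P i z \<Longrightarrow> P j z < P j x \<Longrightarrow> P j x < P j y \<Longrightarrow> False"
    and mem: "x \<in> {1..n} \<times> {1..m}" "y \<in> {1..n} \<times> {1..m}" "z \<in> {1..n} \<times> {1..m}"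
    and cycle: "tree_less (chain_inv n m P) x y" "tree_less (chain_inv n m P) y z"
      "tree_less (chain_inv n m P) z x"
  shows False
proof -
  let ?L = "{1..n} \<times> {1..m}"
  let ?R = "\<lambda>a i b j. if a = b then i < j else if a < b then P j a < P j b else P i a < P i b"
  have eq: False if mem: "(a, i) \<in> ?L" "(a, j) \<in> ?L" "(c, k) \<in> ?L"
    and cyc: "?R a i a j" "?R a j c k" "?R c k a i" for a c i j k
  proof -
    have ij: "i < j" using cyc(1) by simp
    consider "a = c" | "a < c" | "c < a" by linarith
    then show False
    proof cases
      case 3
      then have "P j a < P j c" "P i c < P i a" using cyc by simp_all
      then show False using mono[of i j c a] ij mem 3 by simp
    qed (use cyc in simp_all)
  qed
  \<comment> \<open>With \<open>c\<close> the largest letter, the cycle forces two distinct indices, and the orders of \<open>a\<close>, \<open>b\<close>, \<open>c\<close>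
    at these two indices form the pattern 231.\<close>
  have max: False if mem: "(a, i) \<in> ?L" "(b, j) \<in> ?L" "(c, k) \<in> ?L"
    and cyc: "?R a i b j" "?R b j c k" "?R c k a i" and c: "a < c" "b < c" "a \<noteq> b" for a b c i j k
  proof -
    have k: "P k b < P k c" "P k c < P k a" using cyc c by simp_all
    have mem': "a \<in> {1..n}" "b \<in> {1..n}" "c \<in> {1..n}" "1 \<le> i" "i \<le> m" "1 \<le> j" "j \<le> m" "1 \<le> k" "k \<le> m"
      using mem by simp_all
    show False
    proof (cases "a < b")
      case True
      then have j: "P j a < P j b" using cyc by simp
      \<comment> \<open>Inversions can only disappear as the index grows. The pair (a, b) is
        inverted at \<open>k\<close> and not at \<open>j\<close>, so k < j; then (b, c), not
        inverted at \<open>k\<close>, is not inverted at \<open>j\<close> either. The orders are b c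
        a at \<open>k\<close> and a b c at \<open>j\<close>.\<close>
      have "\<not> j \<le> k"
        using mono[of j k a b] True j k mem' by linarith
      then have "k < j" by simp
      then have "P j b < P j c"
        using mono[of k j b c] inj[of b c j] c k mem' by force
      then show False using avoid[of k j b c a] \<open>k < j\<close> mem' k j by blast
    next
      case False
      then have b: "b < a" "P i a < P i b" using cyc c by simp_all
      \<comment> \<open>Symmetrically, (b, a) is inverted at \<open>i\<close> and not at
        \<open>k\<close>, so i < k, and the inversion (a, c) at \<open>k\<close> is inherited by
        \<open>i\<close>. The orders are c a b at \<open>i\<close> and b c a at
        \<open>k\<close>.\<close>
      have "\<not> k \<le> i" using mono[of k i b a] b k mem' by linarith
      then have "i < k" by simp
      then have "P i c < P i a" using mono[of i k a c] c k mem' by simp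
      then show False using avoid[of i k c a b] \<open>i < k\<close> mem' k b by blast
    qed
  qed
  obtain a i b j c k where xyz: "x = (a, i)" "y = (b, j)" "z = (c, k)"
    by (metis surj_pair)
  note mem' = mem[unfolded xyz]
  have less: "?R a i b j" if "tree_less (chain_inv n m P) (a, i) (b, j)" "(a, i) \<in> ?L" "(b, j) \<in> ?L"
    for a i b j
  proof -
    have "tree_less (chain_inv n m P) (a, i) (b, j) \<longleftrightarrow> ?R a i b j"
    proof (rule tree_less_chain_inv)
      show "P k c \<noteq> P k d" if "c \<noteq> d" for k c d using inj that .
    qed (rule that(2,3))+
    with that(1) show ?thesis by (rule iffD1[rotated])
  qed
  have R: "?R a i b j" "?R b j c k" "?R c k a i"
    using less[OF cycle(1)[unfolded xyz] mem'(1,2)] less[OF cycle(2)[unfolded xyz] mem'(2,3)]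
      less[OF cycle(3)[unfolded xyz] mem'(3,1)] .
  consider "a = b" | "b = c" | "c = a" | "a \<noteq> b" "a < c" "b < c" | "b \<noteq> c" "b < a" "c < a" | "c \<noteq> a" "c < b" "a < b"
    by linarith
  then show False
  proof cases
    case 1
    show ?thesis by (rule eq[OF mem'(1,2,3)[folded 1] R(1,2,3)[folded 1]])
  next
    case 2
    show ?thesis by (rule eq[OF mem'(2,3,1)[folded 2] R(2,3,1)[folded 2]])
  next
    case 3
    show ?thesis by (rule eq[OF mem'(3,1,2)[folded 3] R(3,1,2)[folded 3]])
  next
    case 4
    show ?thesis by (rule max[OF mem'(1,2,3) R(1,2,3) 4(2,3,1)])
  next
    case 5
    show ?thesis by (rule max[OF mem'(2,3,1) R(2,3,1) 5(2,3,1)])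
  next
    case 6
    show ?thesis by (rule max[OF mem'(3,1,2) R(3,1,2) 6(2,3,1)])
  qed
qed

section \<open>From chains to words\<close>

lemma chain_entry_in_set: "length c = m \<Longrightarrow> 1 \<le> i \<Longrightarrow> i \<le> m \<Longrightarrow> chain_entry m c i \<in> set c"
  by (simp add: chain_entry_def)

lemma chain_entry_permutes:
  "c \<in> metasylv_chains n m \<Longrightarrow> 1 \<le> i \<Longrightarrow> i \<le> m \<Longrightarrow> chain_entry m c i permutes {1..n}"
  using chain_entry_in_set unfolding metasylv_chains_def by blast

lemma chain_inversions_eq:
  assumes "\<And>i. 1 \<le> i \<Longrightarrow> i \<le> m \<Longrightarrow> chain_entry m c i permutes {1..n}"
  shows "chain_inversions n m c = chain_inv n m (\<lambda>i. inv (chain_entry m c i))"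
proof -
  have "(a, b, i) \<in> chain_inversions n m c \<longleftrightarrow> (a, b, i) \<in> chain_inv n m (\<lambda>i. inv (chain_entry m c i))"
    for a b i
  proof (cases "1 \<le> i \<and> i \<le> m")
    case True
    then show ?thesis using coinv_permutes[OF assms[of i]]
      by (simp add: chain_inversions_def chain_inv_def)
  next
    case False
    then show ?thesis by (auto simp: chain_inversions_def chain_inv_def)
  qed
  then show ?thesis by (intro set_eqI) (simp add: split_paired_all)
qed

lemma coinv_chain_mono:
  assumes c: "c \<in> metasylv_chains n m" and "i \<le> j" "1 \<le> i" "j \<le> m"
  shows "coinv n (chain_entry m c j) \<subseteq> coinv n (chain_entry m c i)"
  using assms(2-4)
proof (induction rule: dec_induct)
  case (step j)
  then have "coinv n (chain_entry m c (j + 1)) \<subseteq> coinv n (chain_entry m c j)"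
    using c unfolding metasylv_chains_def weak_le_def by simp
  then show ?case using step by simp
qed simp

lemma word_of_chain:
  assumes c: "c \<in> metasylv_chains n m" and m: "1 \<le> m"
  shows "\<exists>w \<in> mperms n m. avoids_aba w \<and> tree_inv w = chain_inversions n m c"
proof -
  let ?s = "chain_entry m c"
  \<comment> \<open>Outside \<open>{1..m}\<close> the entries are junk; truncating the index keeps \<open>P i\<close> injective.\<close>
  define P where "P i = (if i \<in> {1..m} then inv (?s i) else id)" for i
  note perm = chain_entry_permutes[OF c]
  have T: "chain_inversions n m c = chain_inv n m P"
  proof -
    have "chain_inversions n m c = chain_inv n m (\<lambda>i. inv (?s i))"
      by (rule chain_inversions_eq) (rule perm)
    also have "\<dots> = chain_inv n m P" by (auto simp: chain_inv_def P_def)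
    finally show ?thesis .
  qed
  have inj: "P i a \<noteq> P i b" if "a \<noteq> b" for i a b
  proof (cases "i \<in> {1..m}")
    case True
    then have "inj (inv (?s i))" using permutes_inj[OF permutes_inv[OF perm]] by simp
    then show ?thesis using that True by (simp add: P_def inj_eq)
  next
    case False
    then have "P i = id" by (simp only: P_def if_False)
    then show ?thesis using that by simp
  qed
  have mono: "P i b < P i a" if "1 \<le> i" "i \<le> j" "j \<le> m" "a < b" "a \<in> {1..n}" "b \<in> {1..n}" "P j b < P j a"
    for a b i j
  proof -
    have ij: "1 \<le> j" "i \<le> m" using that by simp_all
    then have "(a, b) \<in> coinv n (?s j)" using that by (simp add: coinv_permutes[OF perm] P_def)
    then have "(a, b) \<in> coinv n (?s i)" using coinv_chain_mono[OF c] that by blast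
    then show ?thesis using that ij by (simp add: coinv_permutes[OF perm] P_def)
  qed
  have avoid: False if ij: "1 \<le> i" "i < j" "j \<le> m" and mem: "x \<in> {1..n}" "y \<in> {1..n}" "z \<in> {1..n}"
    and lt: "P i x < P i y" "P i y < P i z" "P j z < P j x" "P j x < P j y" for x y z i j
  proof -
    have "avoids_231 n (inv (?s j) \<circ> ?s i)" using c ij unfolding metasylv_chains_def by blast
    moreover have "?s i permutes {1..n}" using perm ij by simp
    moreover have "P i = inv (?s i)" "P j = inv (?s j)" using ij by (simp_all add: P_def)
    ultimately show False using avoids_231_permutes[of "?s i" n "?s j"] mem lt by auto
  qed
  show ?thesis unfolding T
  proof (rule word_of_tree_less[OF m])
    show "1 \<le> a \<and> a < b \<and> b \<le> n \<and> 1 \<le> i \<and> i \<le> m" if "(a, b, i) \<in> chain_inv n m P" for a b i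
      using that by (simp add: chain_inv_def)
    show "tree_less (chain_inv n m P) x z"
      if "x \<in> {1..n} \<times> {1..m}" "y \<in> {1..n} \<times> {1..m}" "z \<in> {1..n} \<times> {1..m}"
        "tree_less (chain_inv n m P) x y" "tree_less (chain_inv n m P) y z" for x y z
    proof (rule ccontr)
      assume "\<not> tree_less (chain_inv n m P) x z"
      moreover have "x \<noteq> z" using that(4,5) tree_less_asym by blast
      \<comment> \<open>In a tournament a failure of transitivity is a 3-cycle.\<close>
      ultimately have "tree_less (chain_inv n m P) z x" using tree_less_total by blast
      note cycle = that(4,5) this
      show False
      proof (rule chain_inv_acyclic[of P m n x y z])
        show "P i a \<noteq> P i b" if "a \<noteq> b" for i a b using that by (rule inj)
        show "P i b < P i a" if "1 \<le> i" "i \<le> j" "j \<le> m" "a < b" "a \<in> {1..n}" "b \<in> {1..n}"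
          "P j b < P j a" for a b i j
          using that by (rule mono)
        show False if "1 \<le> i" "i < j" "j \<le> m" "x \<in> {1..n}" "y \<in> {1..n}" "z \<in> {1..n}"
          "P i x < P i y" "P i y < P i z" "P j z < P j x" "P j x < P j y" for x y z i j
          using that by (rule avoid)
      qed (rule that(1-3) cycle)+
    qed
  qed
qed

section \<open>From words to chains\<close>

text \<open>The i-th copy of b stands to the left of the j-th. For the chain read off from the word,
  this becomes the weak order condition.\<close>

lemma tree_inv_mono:
  assumes w: "w \<in> mperms n m" and "1 \<le> i" "i \<le> j" and T: "(a, b, j) \<in> tree_inv w"
  shows "(a, b, i) \<in> tree_inv w"
proof (cases "i = j")
  case False
  have range: "1 \<le> a \<and> a < b \<and> b \<le> n \<and> 1 \<le> j \<and> j \<le> m" using tree_inv_range[OF w T] .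
  then have mem: "(b, i) \<in> set (labels w)" "(b, j) \<in> set (labels w)"
    using assms by (simp_all add: set_labels_mperms[OF w])
  have "\<not> precedes (labels w) (b, j) (b, i)"
    using sorted_wrt_precedesD[OF sorted_labels, of w "(b, j)" "(b, i)"] assms(3) by auto
  then have "precedes (labels w) (b, i) (b, j)" using precedes_total[OF mem] False by simp
  then show ?thesis using T precedes_trans[OF distinct_labels, of w "(b, i)" "(b, j)"]
    by (simp add: tree_inv_def)
qed (use T in simp)

lemma chain_of_word:
  assumes w: "w \<in> mperms n m" "avoids_aba w"
  shows "\<exists>c \<in> metasylv_chains n m. chain_inversions n m c = tree_inv w"
proof -
  let ?L = "{1..n} \<times> {1..m}"
  define T where "T = tree_inv w"
  have asym: "tree_less T x y \<Longrightarrow> \<not> tree_less T y x" for x y by (rule tree_less_asym)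
  have trans: "tree_less T x z"
    if "x \<in> ?L" "y \<in> ?L" "z \<in> ?L" "tree_less T x y" "tree_less T y z" for x y z
    using that precedes_trans[OF distinct_labels] unfolding T_def
    by (metis tree_less_iff_precedes[OF w])
  have mono: "(a, b, i) \<in> T" if "(a, b, j) \<in> T" "1 \<le> i" "i \<le> j" for a b i j
    using tree_inv_mono[OF w(1)] that unfolding T_def by blast
  have "\<exists>s. s permutes {1..n} \<and>
      (\<forall>a\<in>{1..n}. \<forall>b\<in>{1..n}. inv s a < inv s b \<longleftrightarrow> tree_less T (a, i) (b, i))" if "i \<in> {1..m}" for i
  proof (rule ex_permutes_of_order)
    show "tree_less T (a, i) (c, i)"
      if "a \<in> {1..n}" "b \<in> {1..n}" "c \<in> {1..n}" "tree_less T (a, i) (b, i)" "tree_less T (b, i) (c, i)"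
      for a b c
      by (rule trans[of "(a, i)" "(b, i)"]) (use that \<open>i \<in> {1..m}\<close> in simp_all)
  qed (use asym in blast, use tree_less_total in blast)
  then obtain s where s: "\<And>i. i \<in> {1..m} \<Longrightarrow> s i permutes {1..n}"
    and lt: "\<And>i a b. i \<in> {1..m} \<Longrightarrow> a \<in> {1..n} \<Longrightarrow> b \<in> {1..n} \<Longrightarrow>
      inv (s i) a < inv (s i) b \<longleftrightarrow> tree_less T (a, i) (b, i)"
    by metis
  \<comment> \<open>A chain lists its highest index first, so list place k holds the permutation of
    index m - k.\<close>
  define c where "c = map (\<lambda>k. s (m - k)) [0..<m]"
  have entry: "chain_entry m c i = s i" if "i \<in> {1..m}" for i
    using that by (simp add: chain_entry_def c_def)
  have coinv: "(a, b) \<in> coinv n (s i) \<longleftrightarrow> (a, b, i) \<in> T" if i: "i \<in> {1..m}" for a b i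
  proof (cases "a < b \<and> a \<in> {1..n} \<and> b \<in> {1..n}")
    case True
    then have "(a, b) \<in> coinv n (s i) \<longleftrightarrow> tree_less T (b, i) (a, i)"
      using lt[OF i, of b a] by (simp add: coinv_permutes[OF s[OF i]])
    then show ?thesis using True by (simp add: tree_less_def)
  next
    case False
    have "(a, b, i) \<notin> T" using tree_inv_range[OF w(1), of a b i] False unfolding T_def by auto
    moreover have "(a, b) \<notin> coinv n (s i)" using False unfolding coinv_permutes[OF s[OF i]] by blast
    ultimately show ?thesis by blast
  qed
  have weak: "weak_le n (chain_entry m c (i + 1)) (chain_entry m c i)" if i: "1 \<le> i" "i < m" for i
  proof -
    have "coinv n (s (i + 1)) \<subseteq> coinv n (s i)"
    proof (rule subrelI)
      fix a b assume "(a, b) \<in> coinv n (s (i + 1))"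
      then have "(a, b, i + 1) \<in> T" using coinv[of "i + 1" a b] i by simp
      then have "(a, b, i) \<in> T" using mono[of a b "i + 1" i] i by simp
      then show "(a, b) \<in> coinv n (s i)" using coinv[of i a b] i by simp
    qed
    then show ?thesis using entry[of i] entry[of "i + 1"] i by (simp add: weak_le_def)
  qed
  have avoid: "avoids_231 n (inv (chain_entry m c j) \<circ> chain_entry m c i)"
    if ij: "1 \<le> i" "i < j" "j \<le> m" for i j
  proof -
    have mem_ij: "i \<in> {1..m}" "j \<in> {1..m}" using ij by simp_all
    have False if mem: "x \<in> {1..n}" "y \<in> {1..n}" "z \<in> {1..n}"
      and "inv (s i) x < inv (s i) y" "inv (s i) y < inv (s i) z"
        "inv (s j) z < inv (s j) x" "inv (s j) x < inv (s j) y" for x y z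
    proof -
      have xy: "tree_less T (x, i) (y, i)" and yz: "tree_less T (y, i) (z, i)"
        and zx: "tree_less T (z, j) (x, j)" and xy': "tree_less T (x, j) (y, j)"
        using that lt mem_ij by blast+
      have zy: "tree_less T (z, j) (y, j)" and xz: "tree_less T (x, i) (z, i)"
        using trans[OF _ _ _ zx xy'] trans[OF _ _ _ xy yz] mem mem_ij by simp_all
      have neq: "x \<noteq> y" "z \<noteq> x" "z \<noteq> y" using xy zx zy asym by blast+
      \<comment> \<open>\<open>z\<close> moves from behind \<open>u\<close> to before \<open>u\<close> as the index grows from \<open>i\<close> to \<open>j\<close>; hence \<open>z\<close> is
        the smaller letter and all copies of \<open>z\<close> lie after \<open>u\<^sub>i\<close>.\<close>
      have small: "tree_less T (u, i) (z, j)"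
        if u: "tree_less T (u, i) (z, i)" "tree_less T (z, j) (u, j)" "z \<noteq> u" for u
      proof -
        have "\<not> u < z" using u mono[of u z j i] ij by (auto simp: tree_less_def)
        then have "z < u" using u(3) by simp
        then show ?thesis using u(1) by (simp add: tree_less_def)
      qed
      have "tree_less T (y, i) (z, j)" using small[of y] yz zy neq by blast
      then have yx: "tree_less T (y, i) (x, j)" using trans[OF _ _ _ _ zx] mem mem_ij by simp
      \<comment> \<open>Now \<open>y_i\<close> comes before \<open>x_j\<close>. If x < y, then
        \<open>y_i\<close> lies between \<open>x_i\<close> and \<open>x_j\<close>; if y < x, then
        \<open>x_j\<close> lies between \<open>y_i\<close> and \<open>y_j\<close>. Either way a
        larger letter separates two copies of a smaller one.\<close>
      show False
        using xy yx xy' neq by (cases "x < y") (auto simp: tree_less_def)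
    qed
    then show ?thesis unfolding entry[OF mem_ij(1)] entry[OF mem_ij(2)]
      avoids_231_permutes[OF s[OF mem_ij(1)]] by blast
  qed
  have set_c: "\<forall>t\<in>set c. t permutes {1..n}" using s by (auto simp: c_def)
  have "c \<in> metasylv_chains n m"
    unfolding metasylv_chains_def using weak avoid set_c by (simp add: c_def)
  moreover have "(a, b, i) \<in> chain_inversions n m c \<longleftrightarrow> (a, b, i) \<in> T" for a b i
  proof (cases "i \<in> {1..m}")
    case True
    then show ?thesis using coinv[OF True] entry[OF True] by (simp add: chain_inversions_def)
  next
    case False
    then show ?thesis using tree_inv_range[OF w(1), of a b i] unfolding T_def
      by (auto simp: chain_inversions_def)
  qed
  then have "chain_inversions n m c = T" by (intro set_eqI) (simp add: split_paired_all)
  ultimately show ?thesis unfolding T_def by blast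
qed

section \<open>Assembling the bijection\<close>

text \<open>The co-inversions of each entry are a slice of the set of triples at a fixed index, and
  they determine the permutation.\<close>

lemma chain_inversions_inj: "inj_on (chain_inversions n m) (metasylv_chains n m)"
proof (rule inj_onI)
  fix c d
  assume c: "c \<in> metasylv_chains n m" and d: "d \<in> metasylv_chains n m"
    and eq: "chain_inversions n m c = chain_inversions n m d"
  have entry: "chain_entry m c i = chain_entry m d i" if i: "1 \<le> i" "i \<le> m" for i
  proof (rule coinv_inj)
    show "chain_entry m c i permutes {1..n}" "chain_entry m d i permutes {1..n}"
      using chain_entry_permutes c d i by blast+
    have "coinv n (chain_entry m e i) = {(a, b). (a, b, i) \<in> chain_inversions n m e}" for e
      using i by (simp add: chain_inversions_def)
    then show "coinv n (chain_entry m c i) = coinv n (chain_entry m d i)" by (simp add: eq)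
  qed
  have len: "length c = m" "length d = m" using c d by (simp_all add: metasylv_chains_def)
  show "c = d"
  proof (rule nth_equalityI)
    fix k assume "k < length c"
    then show "c ! k = d ! k" using entry[of "m - k"] len by (simp add: chain_entry_def)
  qed (simp add: len)
qed

lemma class_tree_inversions:
  assumes C: "C \<in> metasylv_classes n m" and m: "1 \<le> m"
    and w: "w \<in> C" "w \<in> mperms n m" "avoids_aba w"
  shows "tree_inversions n m C = tree_inv w"
  using tree_inversions_eq[OF w(2) m max_elem_eq[OF C w(1,3)]] .

lemma tree_inversions_inj:
  assumes m: "1 \<le> m"
  shows "inj_on (tree_inversions n m) (metasylv_classes n m)"
proof (rule inj_onI)
  fix C D
  assume C: "C \<in> metasylv_classes n m" and D: "D \<in> metasylv_classes n m"
    and eq: "tree_inversions n m C = tree_inversions n m D"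
  obtain w where w: "w \<in> C" "w \<in> mperms n m" "avoids_aba w" using class_has_avoids_aba[OF C] .
  obtain v where v: "v \<in> D" "v \<in> mperms n m" "avoids_aba v" using class_has_avoids_aba[OF D] .
  have "tree_inv w = tree_inv v"
    using eq class_tree_inversions[OF C m w] class_tree_inversions[OF D m v] by simp
  then have "w = v" using tree_inv_inj w v by blast
  then show "C = D" using classes_eqI[OF C D w(1)] v(1) by simp
qed

text \<open>Since both maps into the sets of triples are injective, equality of their images makes
  \<open>psi\<close> the composite of \<open>chain_inversions\<close> with the inverse of
  \<open>tree_inversions\<close>, which is well defined and bijective.\<close>

lemma image_tree_inversions:
  assumes m: "1 \<le> m"
  shows "tree_inversions n m ` metasylv_classes n m = chain_inversions n m ` metasylv_chains n m"
proof (intro subset_antisym image_subsetI)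
  fix C assume C: "C \<in> metasylv_classes n m"
  obtain w where w: "w \<in> C" "w \<in> mperms n m" "avoids_aba w" using class_has_avoids_aba[OF C] .
  obtain c where "c \<in> metasylv_chains n m" "chain_inversions n m c = tree_inv w"
    using chain_of_word[OF w(2,3)] by blast
  then show "tree_inversions n m C \<in> chain_inversions n m ` metasylv_chains n m"
    using class_tree_inversions[OF C m w] by (metis image_eqI)
next
  fix c assume "c \<in> metasylv_chains n m"
  then obtain w where w: "w \<in> mperms n m" "avoids_aba w" "tree_inv w = chain_inversions n m c"
    using word_of_chain[OF _ m] by blast
  obtain C where C: "C \<in> metasylv_classes n m" "w \<in> C" using ex_class[OF w(1)] .
  then show "chain_inversions n m c \<in> tree_inversions n m ` metasylv_classes n m"
    using class_tree_inversions[OF C(1) m C(2) w(1,2)] w(3) by (metis image_eqI)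
qed

theorem theorem4p5:
  fixes m n :: nat
  assumes "1 \<le> m" and "1 \<le> n"
  shows "(\<forall>c \<in> metasylv_chains n m.
            \<exists>!C. C \<in> metasylv_classes n m \<and>
                 tree_inversions n m C = chain_inversions n m c) \<and>
         bij_betw (psi n m) (metasylv_chains n m) (metasylv_classes n m)"
proof
  note img = image_tree_inversions[OF assms(1), of n]
  note inj = tree_inversions_inj[OF assms(1), of n]
  show ex1: "\<forall>c \<in> metasylv_chains n m. \<exists>!C. C \<in> metasylv_classes n m \<and>
    tree_inversions n m C = chain_inversions n m c"
  proof
    fix c assume "c \<in> metasylv_chains n m"
    then have "chain_inversions n m c \<in> tree_inversions n m ` metasylv_classes n m"
      unfolding img by (rule imageI)
    then show "\<exists>!C. C \<in> metasylv_classes n m \<and> tree_inversions n m C = chain_inversions n m c"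
      using inj by (auto dest: inj_onD)
  qed
  have psi: "psi n m c \<in> metasylv_classes n m"
    "tree_inversions n m (psi n m c) = chain_inversions n m c" if "c \<in> metasylv_chains n m" for c
    using theI'[OF ex1[rule_format, OF that]] unfolding psi_def by blast+
  show "bij_betw (psi n m) (metasylv_chains n m) (metasylv_classes n m)"
    unfolding bij_betw_def
  proof
    show "inj_on (psi n m) (metasylv_chains n m)"
      using psi(2) chain_inversions_inj by (metis inj_on_def)
    show "psi n m ` metasylv_chains n m = metasylv_classes n m"
    proof (intro subset_antisym image_subsetI subsetI)
      fix C assume C: "C \<in> metasylv_classes n m"
      then obtain c where c: "c \<in> metasylv_chains n m" "tree_inversions n m C = chain_inversions n m c"
        using img by blast
      then have "C = psi n m c" using inj_onD[OF inj _ C psi(1)] psi(2) by metis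
      then show "C \<in> psi n m ` metasylv_chains n m" using c(1) by blast
    qed (rule psi(1))
  qed
qed

end
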